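(* Let $X$ be a Fréchet sequence space in which $(e_n)_{n\geq 0}$ is a basis, with topology defined by an increasing sequence of seminorms $(\|\cdot\|_n)_{n\ge1}$. Let $w=(w_n)_{n\ge1}$ be a sequence of non-zero scalars and suppose that the weighted backward shift $B_w$ is an operator on $X$. Let $\mathcal{A}$ be a finitely invariant (f.i.) Furstenberg family. Consider the condition: (C) there exists a sequence $(\varepsilon_p)_{p\geq 1}$ of positive numbers with $\varepsilon_p\to 0$ as $p\to\infty$ and a sequence $(A_p)_{p\geq 1}$ of pairwise disjoint sets in $\mathcal{A}$ such that (i) for any $p\geq 1$, $\displaystyle\sum_{n\in A_p} \frac{1}{\prod_{\nu=1}^{n+p} w_\nu}e_{n+p}$ converges in $X$; (ii) for any $p,q\geq 1$, any $m\in A_q$, and any $j=0,\ldots,p$, $\displaystyle\Big\|\sum _{n\in A_p,\, n>m} \frac{1}{\prod_{\nu=1}^{n-m+j} w_\nu} e_{n-m+j}\Big\|_q <\min(\varepsilon_p,\varepsilon_q)$. (a) If (C) holds, then $B_w$ is $\mathcal{A}$-hypercyclic. (b) If $(e_n)_{n\geq 0}$ is an unconditional basis, then the converse also holds, that is, if $B_w$ is $\mathcal{A}$-hypercyclic then (C) holds. Moreover, in (C) one may replace "there exists a sequence $(\varepsilon_p)_{p\geq 1}$ of positive numbers with $\varepsilon_p\to0$" equivalently by "for any sequence $(\varepsilon_p)_{p\geq 1}$ of positive numbers with $\varepsilon_p\to0$" (there exists a sequence $(A_p)_{p\ge1}$ as described).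
   Context: Let $\mathbb{N}_0=\{0,1,2,\ldots\}$. A Furstenberg family is a non-empty family $\mathcal{A}$ of subsets of $\mathbb{N}_0$ that is hereditary upward: $A\in\mathcal{A}$, $B\supset A$ imply $B\in\mathcal{A}$. It is called finitely invariant (f.i.) if, for any $A\in \mathcal{A}$ and all $n\geq 0$, $A\setminus [0,n] \in \mathcal{A}$. A continuous map $T:X\to X$ is $\mathcal{A}$-hypercyclic if there exists $x\in X$ such that, for any non-empty open set $U$ in $X$, $\{ n\geq 0 : T^nx\in U\}\in \mathcal{A}$. A Fréchet sequence space is a Fréchet space that is a subspace of $\mathbb{K}^{\mathbb{N}_0}$ ($\mathbb{K}=\mathbb{R}$ or $\mathbb{C}$) and such that each coordinate functional $x=(x_n)_{n\geq 0}\mapsto x_k$, $k\geq 0$, is continuous. $e_n=(\delta_{n,k})_{k\geq 0}$ are the canonical unit sequences. The weighted backward shift is $B_w((x_n)_{n\geq 0})=(w_{n+1}x_{n+1})_{n\geq 0}$. An operator on $X$ is a continuous linear map $X\to X$. Sums over subsets of $\mathbb{N}_0$ are taken in increasing order of the index; the series in (ii) converges automatically once (i) holds, by continuity of $B_w$. *)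

theory Defs
  imports "HOL-Analysis.Analysis" "HOL-Library.Function_Algebras"
begin

text \<open>
  Scalars range over the sort \<open>{real_normed_field, euclidean_space}\<close>, of which \<open>real\<close> and \<open>complex\<close>
  are instances and, by the theorem of Frobenius, the only ones up to isomorphism.
  Addition and zero of sequences come from \<^theory>\<open>HOL-Library.Function_Algebras\<close>.
\<close>

definition seq_scale :: "'k::field \<Rightarrow> (nat \<Rightarrow> 'k) \<Rightarrow> nat \<Rightarrow> 'k"  (infixr "*\<^sub>s" 75)
  where "c *\<^sub>s x = (\<lambda>n. c * x n)"

global_interpretation seq: vector_space "seq_scale :: 'k::field \<Rightarrow> (nat \<Rightarrow> 'k) \<Rightarrow> nat \<Rightarrow> 'k"
  by unfold_locales (auto simp: seq_scale_def fun_eq_iff algebra_simps)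

definition unit_seq :: "nat \<Rightarrow> nat \<Rightarrow> 'k::field"
  where "unit_seq n = (\<lambda>k. if k = n then 1 else 0)"

definition seminorm_on :: "(nat \<Rightarrow> 'k::real_normed_field) set \<Rightarrow> ((nat \<Rightarrow> 'k) \<Rightarrow> real) \<Rightarrow> bool"
  where "seminorm_on X q \<longleftrightarrow>
    (\<forall>x\<in>X. \<forall>y\<in>X. q (x + y) \<le> q x + q y) \<and> (\<forall>c. \<forall>x\<in>X. q (c *\<^sub>s x) = norm c * q x)"

text \<open>Sequences of seminorms are indexed from 1; the value at index 0 is never used.\<close>

definition seminorm_topology ::
    "(nat \<Rightarrow> 'k::real_normed_field) set \<Rightarrow> (nat \<Rightarrow> (nat \<Rightarrow> 'k) \<Rightarrow> real) \<Rightarrow> (nat \<Rightarrow> 'k) topology"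
  where "seminorm_topology X nrm =
    topology_generated_by {{y \<in> X. nrm n (y - x) < r} | n x r. n \<ge> 1 \<and> x \<in> X \<and> r > 0}"

definition frechet_space ::
    "(nat \<Rightarrow> 'k::real_normed_field) set \<Rightarrow> (nat \<Rightarrow> (nat \<Rightarrow> 'k) \<Rightarrow> real) \<Rightarrow> bool"
  where "frechet_space X nrm \<longleftrightarrow>
    seq.subspace X \<and>
    (\<forall>n\<ge>1. seminorm_on X (nrm n)) \<and>
    (\<forall>m\<ge>1. \<forall>n\<ge>m. \<forall>x\<in>X. nrm m x \<le> nrm n x) \<and>
    (\<forall>x\<in>X. (\<forall>n\<ge>1. nrm n x = 0) \<longrightarrow> x = 0) \<and>
    (\<forall>u. range u \<subseteq> X \<and> (\<forall>n\<ge>1. \<forall>r>0. \<exists>N. \<forall>i\<ge>N. \<forall>j\<ge>N. nrm n (u i - u j) < r) \<longrightarrow>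
      (\<exists>x. limitin (seminorm_topology X nrm) u x sequentially))"

definition frechet_sequence_space ::
    "(nat \<Rightarrow> 'k::real_normed_field) set \<Rightarrow> (nat \<Rightarrow> (nat \<Rightarrow> 'k) \<Rightarrow> real) \<Rightarrow> bool"
  where "frechet_sequence_space X nrm \<longleftrightarrow>
    frechet_space X nrm \<and>
    (\<forall>k. continuous_map (seminorm_topology X nrm) euclidean (\<lambda>x. x k))"

text \<open>Summation over a set of indices, finite or infinite, in increasing order.\<close>

definition series_sums ::
    "(nat \<Rightarrow> 'k::real_normed_field) topology \<Rightarrow> (nat \<Rightarrow> nat \<Rightarrow> 'k) \<Rightarrow> nat set \<Rightarrow> (nat \<Rightarrow> 'k) \<Rightarrow> bool"
  where "series_sums T f S s \<longleftrightarrow> limitin T (\<lambda>N. \<Sum>n\<in>S \<inter> {..<N}. f n) s sequentially"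

definition basis_of :: "(nat \<Rightarrow> 'k::real_normed_field) topology \<Rightarrow> (nat \<Rightarrow> nat \<Rightarrow> 'k) \<Rightarrow> bool"
  where "basis_of T b \<longleftrightarrow>
    range b \<subseteq> topspace T \<and>
    (\<forall>x\<in>topspace T. \<exists>!a. series_sums T (\<lambda>n. a n *\<^sub>s b n) UNIV x)"

definition unconditional_basis_of ::
    "(nat \<Rightarrow> 'k::real_normed_field) topology \<Rightarrow> (nat \<Rightarrow> nat \<Rightarrow> 'k) \<Rightarrow> bool"
  where "unconditional_basis_of T b \<longleftrightarrow>
    basis_of T b \<and>
    (\<forall>x\<in>topspace T. \<forall>a. series_sums T (\<lambda>n. a n *\<^sub>s b n) UNIV x \<longrightarrow>
      (\<forall>\<pi>. bij \<pi> \<longrightarrow> (\<exists>s. series_sums T (\<lambda>n. a (\<pi> n) *\<^sub>s b (\<pi> n)) UNIV s)))"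

definition operator_on ::
    "(nat \<Rightarrow> 'k::real_normed_field) topology \<Rightarrow> ((nat \<Rightarrow> 'k) \<Rightarrow> nat \<Rightarrow> 'k) \<Rightarrow> bool"
  where "operator_on T L \<longleftrightarrow>
    continuous_map T T L \<and>
    (\<forall>x\<in>topspace T. \<forall>y\<in>topspace T. L (x + y) = L x + L y) \<and>
    (\<forall>c. \<forall>x\<in>topspace T. L (c *\<^sub>s x) = c *\<^sub>s L x)"

definition weighted_shift :: "(nat \<Rightarrow> 'k::field) \<Rightarrow> (nat \<Rightarrow> 'k) \<Rightarrow> nat \<Rightarrow> 'k"
  where "weighted_shift w x = (\<lambda>n. w (n + 1) * x (n + 1))"

definition furstenberg_family :: "nat set set \<Rightarrow> bool"
  where "furstenberg_family \<A> \<longleftrightarrow> \<A> \<noteq> {} \<and> (\<forall>A B. A \<in> \<A> \<and> A \<subseteq> B \<longrightarrow> B \<in> \<A>)"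

definition finitely_invariant :: "nat set set \<Rightarrow> bool"
  where "finitely_invariant \<A> \<longleftrightarrow> (\<forall>A\<in>\<A>. \<forall>n. A - {0..n} \<in> \<A>)"

definition hypercyclic_wrt :: "nat set set \<Rightarrow> 'a topology \<Rightarrow> ('a \<Rightarrow> 'a) \<Rightarrow> bool"
  where "hypercyclic_wrt \<A> T f \<longleftrightarrow>
    continuous_map T T f \<and>
    (\<exists>x\<in>topspace T. \<forall>U. openin T U \<and> U \<noteq> {} \<longrightarrow> {n. (f ^^ n) x \<in> U} \<in> \<A>)"

definition positive_null_seq :: "(nat \<Rightarrow> real) \<Rightarrow> bool"
  where "positive_null_seq \<epsilon> \<longleftrightarrow> (\<forall>p\<ge>1. \<epsilon> p > 0) \<and> \<epsilon> \<longlonglongrightarrow> 0"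

text \<open>Existence of the sets \<open>A\<^sub>p\<close> for a given sequence \<open>\<epsilon>\<close>. The convergence of the second series is
  stated along with the estimate for its sum.\<close>

definition shift_condition ::
    "(nat \<Rightarrow> 'k::real_normed_field) set \<Rightarrow> (nat \<Rightarrow> (nat \<Rightarrow> 'k) \<Rightarrow> real) \<Rightarrow> (nat \<Rightarrow> 'k) \<Rightarrow>
      nat set set \<Rightarrow> (nat \<Rightarrow> real) \<Rightarrow> bool"
  where "shift_condition X nrm w \<A> \<epsilon> \<longleftrightarrow>
    (\<exists>A :: nat \<Rightarrow> nat set.
      (\<forall>p\<ge>1. A p \<in> \<A>) \<and> disjoint_family_on A {1..} \<and>
      (\<forall>p\<ge>1. \<exists>s. series_sums (seminorm_topology X nrm)
        (\<lambda>n. (1 / (\<Prod>\<nu>=1..n+p. w \<nu>)) *\<^sub>s unit_seq (n + p)) (A p) s) \<and>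
      (\<forall>p\<ge>1. \<forall>q\<ge>1. \<forall>m\<in>A q. \<forall>j\<le>p. \<exists>s. series_sums (seminorm_topology X nrm)
        (\<lambda>n. (1 / (\<Prod>\<nu>=1..n-m+j. w \<nu>)) *\<^sub>s unit_seq (n - m + j)) {n \<in> A p. n > m} s \<and>
        nrm q s < min (\<epsilon> p) (\<epsilon> q)))"

end

theory Submission
  imports Defs
begin

text \<open>
  Put \<open>v\<^sub>k = 1 / (w\<^sub>1 \<cdots> w\<^sub>k)\<close>. The weighted shift \<open>B\<close> sends \<open>v\<^sub>k\<^sub>+\<^sub>1 e\<^sub>k\<^sub>+\<^sub>1\<close> to \<open>v\<^sub>k e\<^sub>k\<close>, so it merely
  translates the formal series \<open>chi S = \<Sum>\<^bsub>k\<in>S\<^esub> v\<^sub>k e\<^sub>k\<close>. Since the unit sequences are a basis, such a series converges exactly if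
  the sequence \<open>chi S\<close> lies in \<open>X\<close>; condition (C) is therefore a statement about membership and seminorms of
  translates of \<open>chi\<close> (\<open>shift_condition_iff\<close>).

  One null sequence \<open>\<epsilon>\<close> is as good as any other because a fast subsequence of the sets \<open>A\<^sub>p\<close> satisfies (C) with any
  prescribed bounds, offsets and seminorms (\<open>thin_out_shift_condition\<close>).

  From (C) a hypercyclic vector is written down: dense finitely supported sequences \<open>z\<^sub>i\<close> are pulled back
  along all times in \<open>A\<^sub>i\<close> and added up. At a time \<open>m \<in> A\<^sub>l\<close> the orbit shows \<open>z\<^sub>l\<close>, up to the series bounded in
  (C); pullbacks to earlier times have disappeared, since (C) together with continuity of the coordinates
  forces large gaps between the times (\<open>hypercyclic_if_shift_condition\<close>).

  Conversely, the sets \<open>A\<^sub>p\<close> are return times of a hypercyclic vector to neighbourhoods of suitable finite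
  sequences. The series in (C) are then obtained from orbit points by bounded coordinatewise
  multipliers, and for an unconditional basis these multipliers are equicontinuous
  (\<open>multipliers_equicontinuous\<close>, by a gliding hump), which gives
  \<open>shift_condition_if_hypercyclic\<close>.
\<close>

section \<open>Sequences and their coordinatewise restrictions\<close>

lemma sum_seq_apply: "(\<Sum>i\<in>I. f i) k = (\<Sum>i\<in>I. f i k)"
  for f :: "'i \<Rightarrow> nat \<Rightarrow> 'a::comm_monoid_add"
  by (induction I rule: infinite_finite_induct) auto

lemma scale_apply [simp]: "(c *\<^sub>s x) k = c * x k"
  by (simp add: seq_scale_def)

definition restr :: "nat set \<Rightarrow> (nat \<Rightarrow> 'k::zero) \<Rightarrow> nat \<Rightarrow> 'k"
  where "restr S x = (\<lambda>k. if k \<in> S then x k else 0)"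

lemma restr_apply [simp]: "restr S x k = (if k \<in> S then x k else 0)"
  by (simp add: restr_def)

lemma sum_scaled_units:
  "finite F \<Longrightarrow> (\<Sum>n\<in>F. a n *\<^sub>s unit_seq n) = restr F a"
  by (auto simp: fun_eq_iff sum_seq_apply unit_seq_def if_distrib cong: if_cong)

section \<open>Frechet spaces of sequences, by seminorms\<close>

locale frechet_seq =
  fixes X :: "(nat \<Rightarrow> 'k::{real_normed_field, euclidean_space}) set"
    and nrm :: "nat \<Rightarrow> (nat \<Rightarrow> 'k) \<Rightarrow> real"
  assumes frechet: "frechet_sequence_space X nrm"
begin

abbreviation T where "T \<equiv> seminorm_topology X nrm"

lemma subspace_X: "seq.subspace X"
  and seminorm: "n \<ge> 1 \<Longrightarrow> seminorm_on X (nrm n)"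
  and nrm_mono: "1 \<le> m \<Longrightarrow> m \<le> n \<Longrightarrow> x \<in> X \<Longrightarrow> nrm m x \<le> nrm n x"
  and cauchy_limit: "range u \<subseteq> X \<Longrightarrow>
      (\<And>n r. n \<ge> 1 \<Longrightarrow> r > 0 \<Longrightarrow> \<exists>N. \<forall>i\<ge>N. \<forall>j\<ge>N. nrm n (u i - u j) < r) \<Longrightarrow>
      \<exists>x. limitin T u x sequentially"
  and coord_continuous: "continuous_map T euclidean (\<lambda>x. x k)"
proof -
  have F: "frechet_space X nrm" and C: "\<forall>k. continuous_map T euclidean (\<lambda>x. x k)"
    using frechet by (simp_all add: frechet_sequence_space_def)
  show "seq.subspace X" using F by (simp add: frechet_space_def)
  show "n \<ge> 1 \<Longrightarrow> seminorm_on X (nrm n)" using F by (simp add: frechet_space_def)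
  show "1 \<le> m \<Longrightarrow> m \<le> n \<Longrightarrow> x \<in> X \<Longrightarrow> nrm m x \<le> nrm n x" using F by (simp add: frechet_space_def)
  show "continuous_map T euclidean (\<lambda>x. x k)" using C by simp
  assume "range u \<subseteq> X" "\<And>n r. n \<ge> 1 \<Longrightarrow> r > 0 \<Longrightarrow> \<exists>N. \<forall>i\<ge>N. \<forall>j\<ge>N. nrm n (u i - u j) < r"
  then show "\<exists>x. limitin T u x sequentially" using F by (simp add: frechet_space_def)
qed

lemmas X_add = seq.subspace_add [OF subspace_X]
  and X_diff = seq.subspace_diff [OF subspace_X]
  and X_scale = seq.subspace_scale [OF subspace_X]
  and X_zero = seq.subspace_0 [OF subspace_X]
  and X_neg = seq.subspace_neg [OF subspace_X]
  and X_sum = seq.subspace_sum [OF subspace_X]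

lemma nrm_scale: "n \<ge> 1 \<Longrightarrow> x \<in> X \<Longrightarrow> nrm n (c *\<^sub>s x) = norm c * nrm n x"
  and nrm_add: "n \<ge> 1 \<Longrightarrow> x \<in> X \<Longrightarrow> y \<in> X \<Longrightarrow> nrm n (x + y) \<le> nrm n x + nrm n y"
  using seminorm unfolding seminorm_on_def by blast+

lemma nrm_zero: "n \<ge> 1 \<Longrightarrow> nrm n 0 = 0"
  using nrm_scale [of n 0 0] X_zero by (simp add: seq_scale_def zero_fun_def)

lemma nrm_minus: "n \<ge> 1 \<Longrightarrow> x \<in> X \<Longrightarrow> nrm n (- x) = nrm n x"
  using nrm_scale [of n x "- 1"] by simp

lemma nrm_minus_commute:
  assumes "n \<ge> 1" "x \<in> X" "y \<in> X" shows "nrm n (x - y) = nrm n (y - x)"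
  using nrm_minus [of n "y - x"] X_diff assms by simp

lemma nrm_diff:
  assumes "n \<ge> 1" "x \<in> X" "y \<in> X" shows "nrm n (x - y) \<le> nrm n x + nrm n y"
  using nrm_add [of n x "- y"] nrm_minus [of n y] X_neg assms by simp

lemma nrm_triangle:
  assumes "n \<ge> 1" "x \<in> X" "y \<in> X" "z \<in> X"
  shows "nrm n (x - z) \<le> nrm n (x - y) + nrm n (y - z)"
proof -
  have "x - z = (x - y) + (y - z)" by (auto simp: fun_eq_iff)
  then show ?thesis using nrm_add [of n "x - y" "y - z"] assms X_diff by simp
qed

lemma nrm_nonneg: "n \<ge> 1 \<Longrightarrow> x \<in> X \<Longrightarrow> 0 \<le> nrm n x"
  using nrm_diff [of n x x] nrm_zero [of n] by simp

lemma nrm_sum: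
  assumes "n \<ge> 1" "\<And>i. i \<in> I \<Longrightarrow> f i \<in> X" shows "nrm n (\<Sum>i\<in>I. f i) \<le> (\<Sum>i\<in>I. nrm n (f i))"
  using assms(2)
proof (induction I rule: infinite_finite_induct)
  case (insert i I)
  then have "nrm n (f i + (\<Sum>i\<in>I. f i)) \<le> nrm n (f i) + nrm n (\<Sum>i\<in>I. f i)"
    using assms(1) by (intro nrm_add X_sum) auto
  moreover have "nrm n (\<Sum>i\<in>I. f i) \<le> (\<Sum>i\<in>I. nrm n (f i))" using insert by blast
  ultimately show ?case unfolding sum.insert [OF insert(1,2)] by linarith
qed (use assms(1) in \<open>simp_all add: nrm_zero\<close>)

lemma topspace_T [simp]: "topspace T = X"
proof -
  have "x \<in> \<Union>{{y \<in> X. nrm n (y - x) < r} | n x r. n \<ge> 1 \<and> x \<in> X \<and> r > 0}" if "x \<in> X" for x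
  proof (rule UnionI)
    show "{y \<in> X. nrm 1 (y - x) < 1} \<in> {{y \<in> X. nrm n (y - x) < r} | n x r. n \<ge> 1 \<and> x \<in> X \<and> r > 0}"
      using that zero_less_one order_refl [of "1::nat"] by blast
    show "x \<in> {y \<in> X. nrm 1 (y - x) < 1}" using that by (simp add: nrm_zero)
  qed
  then show ?thesis
    unfolding seminorm_topology_def topology_generated_by_topspace by blast
qed

text \<open>
  The seminorms increase with their index, so finitely many seminorm conditions follow from a single
  one. Hence the balls of the individual seminorms, which generate the topology as a subbase, are
  even a base.
\<close>
lemma openin_T:
  "openin T U \<longleftrightarrow> U \<subseteq> X \<and> (\<forall>x\<in>U. \<exists>n\<ge>1. \<exists>r>0. {y \<in> X. nrm n (y - x) < r} \<subseteq> U)"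
  (is "_ \<longleftrightarrow> ?P U")
proof
  assume "openin T U"
  then have "generate_topology_on {{y \<in> X. nrm n (y - x) < r} | n x r. n \<ge> 1 \<and> x \<in> X \<and> r > 0} U"
    by (simp add: seminorm_topology_def openin_topology_generated_by)
  then show "?P U"
  proof induction
    case (Int a b)
    show ?case
    proof (intro conjI ballI)
      fix x assume x: "x \<in> a \<inter> b"
      then obtain m r where m: "m \<ge> 1" "r > 0" "{y \<in> X. nrm m (y - x) < r} \<subseteq> a" using Int by blast
      obtain n s where n: "n \<ge> 1" "s > 0" "{y \<in> X. nrm n (y - x) < s} \<subseteq> b" using Int x by blast
      have "{y \<in> X. nrm (max m n) (y - x) < min r s} \<subseteq> a \<inter> b"
      proof
        fix y assume y: "y \<in> {y \<in> X. nrm (max m n) (y - x) < min r s}"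
        have "x \<in> X" using x Int by blast
        then have "nrm m (y - x) \<le> nrm (max m n) (y - x)" "nrm n (y - x) \<le> nrm (max m n) (y - x)"
          using m n y X_diff by (auto intro!: nrm_mono)
        then show "y \<in> a \<inter> b" using y m(3) n(3) by auto
      qed
      then show "\<exists>k\<ge>1. \<exists>t>0. {y \<in> X. nrm k (y - x) < t} \<subseteq> a \<inter> b"
        using m n by (intro exI [of _ "max m n"] conjI exI [of _ "min r s"]) auto
    qed (use Int in blast)
  next
    case (UN K)
    show ?case
    proof (intro conjI ballI)
      fix x assume "x \<in> \<Union>K"
      then obtain k where k: "k \<in> K" "x \<in> k" by blast
      then obtain n r where "n \<ge> 1" "r > 0" "{y \<in> X. nrm n (y - x) < r} \<subseteq> k" using UN by blast
      then show "\<exists>n\<ge>1. \<exists>r>0. {y \<in> X. nrm n (y - x) < r} \<subseteq> \<Union>K" using k(1) by blast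
    qed (use UN in blast)
  next
    case (Basis s)
    then obtain n x r where s: "s = {y \<in> X. nrm n (y - x) < r}" "n \<ge> 1" "x \<in> X" "r > 0" by blast
    have "{z \<in> X. nrm n (z - y) < r - nrm n (y - x)} \<subseteq> s" if "y \<in> s" for y
      using that s nrm_triangle [of n _ y x] by force
    moreover have "r - nrm n (y - x) > 0" if "y \<in> s" for y using that s by simp
    ultimately show ?case using s by blast
  qed auto
next
  assume U: "?P U"
  have "\<exists>V. openin T V \<and> x \<in> V \<and> V \<subseteq> U" if x: "x \<in> U" for x
  proof -
    obtain n r where n: "n \<ge> 1" "r > 0" "{y \<in> X. nrm n (y - x) < r} \<subseteq> U" using U x by blast
    have "x \<in> X" using U x by blast
    then have "openin T {y \<in> X. nrm n (y - x) < r}"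
      unfolding seminorm_topology_def using n by (intro topology_generated_by_Basis) blast
    then show ?thesis using n \<open>x \<in> X\<close> by (intro exI [of _ "{y \<in> X. nrm n (y - x) < r}"]) (auto simp: nrm_zero)
  qed
  then show "openin T U" by (subst openin_subopen) blast
qed

lemma openin_ball:
  assumes "n \<ge> 1" "x \<in> X" "r > 0" shows "openin T {y \<in> X. nrm n (y - x) < r}"
  unfolding seminorm_topology_def using assms by (intro topology_generated_by_Basis) blast

lemma limitin_T:
  "limitin T u x F \<longleftrightarrow> x \<in> X \<and> (\<forall>n\<ge>1. \<forall>r>0. eventually (\<lambda>i. u i \<in> X \<and> nrm n (u i - x) < r) F)"
proof safe
  assume L: "limitin T u x F"
  then show "x \<in> X" by (simp add: limitin_def)
  fix n :: nat and r :: real assume "n \<ge> 1" "r > 0"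
  then have "openin T {y \<in> X. nrm n (y - x) < r}" "x \<in> {y \<in> X. nrm n (y - x) < r}"
    using \<open>x \<in> X\<close> by (auto simp: openin_ball nrm_zero)
  with L have "eventually (\<lambda>i. u i \<in> {y \<in> X. nrm n (y - x) < r}) F"
    unfolding limitin_def by blast
  then show "eventually (\<lambda>i. u i \<in> X \<and> nrm n (u i - x) < r) F" by simp
next
  assume x: "x \<in> X" and *: "\<forall>n\<ge>1. \<forall>r>0. eventually (\<lambda>i. u i \<in> X \<and> nrm n (u i - x) < r) F"
  have "eventually (\<lambda>i. u i \<in> U) F" if U: "openin T U" "x \<in> U" for U
  proof -
    obtain n r where n: "n \<ge> 1" "r > 0" "{y \<in> X. nrm n (y - x) < r} \<subseteq> U" using U openin_T by blast
    with * have "eventually (\<lambda>i. u i \<in> X \<and> nrm n (u i - x) < r) F" by blast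
    then show ?thesis by eventually_elim (use n in blast)
  qed
  then show "limitin T u x F" using x by (simp add: limitin_def)
qed

lemma limit_coord: "limitin T u x F \<Longrightarrow> ((\<lambda>i. u i k) \<longlongrightarrow> x k) F"
  using continuous_map_limit [OF coord_continuous [of k], of u x F] by (simp add: o_def)

lemma limit_coord_eq:
  assumes "limitin T u x sequentially" "eventually (\<lambda>i. u i k = a) sequentially"
  shows "x k = a"
  using LIMSEQ_unique [OF limit_coord [OF assms(1), of k] tendsto_eventually [OF assms(2)]] .

lemma nrm_limit_le:
  assumes "limitin T u x sequentially" "n \<ge> 1" "y \<in> X"
    and "eventually (\<lambda>i. nrm n (u i - y) \<le> b) sequentially"
  shows "nrm n (x - y) \<le> b"
proof (rule field_le_epsilon)
  fix r :: real assume "r > 0"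
  then have "eventually (\<lambda>i. u i \<in> X \<and> nrm n (u i - x) < r) sequentially"
    using assms limitin_T by blast
  then have "eventually (\<lambda>i. nrm n (x - y) \<le> b + r) sequentially"
    using assms(4)
  proof eventually_elim
    case (elim i)
    have "x \<in> X" using assms limitin_T by blast
    then have "nrm n (x - y) \<le> nrm n (u i - x) + nrm n (u i - y)"
      using nrm_triangle [of n x "u i" y] nrm_minus_commute [of n x "u i"] assms elim by simp
    then show ?case using elim by simp
  qed
  then show "nrm n (x - y) \<le> b + r" by simp
qed

text \<open>
  Continuity of the coordinate functionals in quantitative form: a sequence that is small in a suitable
  seminorm has its first coordinates below prescribed bounds.
\<close>
lemma coords_small:
  assumes "\<And>k. k \<le> p \<Longrightarrow> e k > 0"
  shows "\<exists>n\<ge>1. \<exists>r>0. \<forall>x\<in>X. nrm n x < r \<longrightarrow> (\<forall>k\<le>p::nat. norm (x k) < e k)"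
proof -
  let ?U = "\<Inter>k\<in>{..p}. {x \<in> topspace T. x k \<in> ball 0 (e k)}"
  have "openin T ?U"
    by (intro openin_INT2 openin_continuous_map_preimage [OF coord_continuous]) auto
  moreover have "0 \<in> ?U" using assms X_zero by auto
  ultimately obtain n r where "n \<ge> 1" "r > 0" "{y \<in> X. nrm n (y - 0) < r} \<subseteq> ?U"
    using openin_T [of ?U] by blast
  then show ?thesis
    by (intro exI [of _ n] conjI exI [of _ r]) (auto simp: subset_iff)
qed

lemma series_converges:
  assumes u: "range u \<subseteq> X" and s: "\<And>n. n \<ge> 1 \<Longrightarrow> summable (\<lambda>i. nrm n (u i))"
  shows "\<exists>x. limitin T (\<lambda>N. \<Sum>i<N. u i) x sequentially"
proof (rule cauchy_limit)
  show "range (\<lambda>N. \<Sum>i<N. u i) \<subseteq> X" using u by (auto intro!: X_sum)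
  fix n :: nat and r :: real assume n: "n \<ge> 1" and r: "r > 0"
  obtain N where N: "\<And>m k. m \<ge> N \<Longrightarrow> norm (\<Sum>i=m..<k. nrm n (u i)) < r"
    using s [OF n] r unfolding summable_Cauchy by blast
  have *: "nrm n ((\<Sum>i<k. u i) - (\<Sum>i<m. u i)) < r" if "N \<le> m" "m \<le> k" for m k
  proof -
    have "nrm n ((\<Sum>i<k. u i) - (\<Sum>i<m. u i)) = nrm n (\<Sum>i=m..<k. u i)"
      using sum_diff_nat_ivl [of 0 m k u] that by (simp add: atLeast0LessThan)
    also have "\<dots> \<le> (\<Sum>i=m..<k. nrm n (u i))" using n u by (intro nrm_sum) auto
    also have "\<dots> < r" using N [OF that(1), of k] by simp
    finally show ?thesis .
  qed
  have "nrm n ((\<Sum>i<k. u i) - (\<Sum>i<m. u i)) < r" if "N \<le> m" "N \<le> k" for m k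
  proof (cases "m \<le> k")
    case False
    have "(\<Sum>i<k. u i) \<in> X" "(\<Sum>i<m. u i) \<in> X" using u by (auto intro!: X_sum)
    then show ?thesis using * [of k m] that False nrm_minus_commute [OF n] by simp
  qed (use * that in auto)
  then show "\<exists>N. \<forall>i\<ge>N. \<forall>j\<ge>N. nrm n ((\<Sum>i<i. u i) - (\<Sum>i<j. u i)) < r" by blast
qed

end

section \<open>The unit sequences as a basis\<close>

locale frechet_seq_basis = frechet_seq X nrm
  for X :: "(nat \<Rightarrow> 'k::{real_normed_field, euclidean_space}) set" and nrm +
  assumes basis: "basis_of T unit_seq"
begin

lemma X_unit: "unit_seq n \<in> X"
  using basis unfolding basis_of_def by auto

lemma X_restr_finite: "finite F \<Longrightarrow> restr F a \<in> X"
  by (auto simp flip: sum_scaled_units intro!: X_sum X_scale X_unit)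

text \<open>
  The coordinates of the partial sums become stationary, and coordinates depend continuously on the
  sequence. Hence the basis coefficients of a sequence can only be its own entries.
\<close>
lemma expansion_unique:
  assumes "series_sums T (\<lambda>n. a n *\<^sub>s unit_seq n) UNIV x" shows "a = x"
proof
  fix k
  have *: "limitin T (\<lambda>N. restr {..<N} a) x sequentially"
    using assms by (simp add: series_sums_def sum_scaled_units)
  have "eventually (\<lambda>N. restr {..<N} a k = a k) sequentially"
    using eventually_gt_at_top [of k] by eventually_elim simp
  from limit_coord_eq [OF * this] show "a k = x k" by simp
qed

lemma expansion:
  assumes "x \<in> X" shows "limitin T (\<lambda>N. restr {..<N} x) x sequentially"
proof -
  obtain a where a: "series_sums T (\<lambda>n. a n *\<^sub>s unit_seq n) UNIV x"
    using basis assms unfolding basis_of_def by fastforce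
  with expansion_unique [OF a] show ?thesis by (simp add: series_sums_def sum_scaled_units)
qed

text \<open>
  Such a series converges as soon as its coordinatewise sum lies in the space: an element of the space is
  the limit of its own expansion, and the partial sums of the series are among those of the expansion,
  since the indices increase. Convergence in condition (C) thereby turns into mere membership.
\<close>
lemma series_sums_shifted_units:
  assumes S: "\<And>n. n \<in> S \<Longrightarrow> m \<le> n"
  shows "series_sums T (\<lambda>n. a (n - m + j) *\<^sub>s unit_seq (n - m + j)) S s \<longleftrightarrow>
    s \<in> X \<and> s = restr ((\<lambda>n. n - m + j) ` S) a"
proof -
  let ?h = "\<lambda>n. n - m + j"
  have partial: "(\<Sum>n\<in>S \<inter> {..<N}. a (?h n) *\<^sub>s unit_seq (?h n)) = restr (?h ` (S \<inter> {..<N})) a" for N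
  proof -
    have "inj_on ?h (S \<inter> {..<N})"
    proof (rule inj_onI)
      fix a b assume "a \<in> S \<inter> {..<N}" "b \<in> S \<inter> {..<N}" "?h a = ?h b"
      then show "a = b" using S [of a] S [of b] by simp
    qed
    then show ?thesis
      using sum.reindex [of ?h "S \<inter> {..<N}" "\<lambda>n. a n *\<^sub>s unit_seq n"]
      by (simp add: sum_scaled_units)
  qed
  have le: "?h n < N - m + j \<longleftrightarrow> n < N" if "n \<in> S" "N \<ge> m" for n N using S [OF that(1)] that(2) by linarith
  have trunc: "restr (?h ` (S \<inter> {..<N})) a = restr {..<N - m + j} (restr (?h ` S) a)" if "N \<ge> m" for N
  proof
    fix k
    have "k \<in> ?h ` (S \<inter> {..<N}) \<longleftrightarrow> k < N - m + j \<and> k \<in> ?h ` S" using le [OF _ that] by fastforce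
    then show "restr (?h ` (S \<inter> {..<N})) a k = restr {..<N - m + j} (restr (?h ` S) a) k" by simp
  qed
  show ?thesis
  proof
    assume "series_sums T (\<lambda>n. a (?h n) *\<^sub>s unit_seq (?h n)) S s"
    then have L: "limitin T (\<lambda>N. restr (?h ` (S \<inter> {..<N})) a) s sequentially"
      by (simp add: series_sums_def partial)
    have "s k = restr (?h ` S) a k" for k
    proof (rule limit_coord_eq [OF L])
      show "eventually (\<lambda>N. restr (?h ` (S \<inter> {..<N})) a k = restr (?h ` S) a k) sequentially"
        using eventually_gt_at_top [of "k + m"]
        by eventually_elim (subst trunc, auto)
    qed
    then show "s \<in> X \<and> s = restr (?h ` S) a" using L limitin_T by (auto simp: fun_eq_iff)
  next
    assume s: "s \<in> X \<and> s = restr (?h ` S) a"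
    have flt: "filterlim (\<lambda>N. N - m + j) at_top sequentially"
      unfolding filterlim_at_top
    proof
      fix Z show "eventually (\<lambda>N. Z \<le> N - m + j) sequentially"
        using eventually_ge_at_top [of "Z + m"] by eventually_elim simp
    qed
    have "limitin T (\<lambda>N. restr {..<N - m + j} s) s sequentially"
      using expansion [of s] s eventually_compose_filterlim [OF _ flt] by (auto simp: limitin_T)
    moreover have "eventually (\<lambda>N. restr {..<N - m + j} s = restr (?h ` (S \<inter> {..<N})) a) sequentially"
      using eventually_ge_at_top [of m] by eventually_elim (use s trunc in simp)
    ultimately have "limitin T (\<lambda>N. restr (?h ` (S \<inter> {..<N})) a) s sequentially"
      by (rule limitin_transform_eventually [rotated])
    then show "series_sums T (\<lambda>n. a (?h n) *\<^sub>s unit_seq (?h n)) S s"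
      by (simp add: series_sums_def partial)
  qed
qed

lemma nrm_combination_le:
  assumes "n \<ge> 1" "\<And>j. j \<in> J \<Longrightarrow> x j \<in> X \<and> nrm n (x j) \<le> b"
  shows "nrm n (\<Sum>j\<in>J. c j *\<^sub>s x j) \<le> (\<Sum>j\<in>J. norm (c j)) * b"
proof -
  have "nrm n (\<Sum>j\<in>J. c j *\<^sub>s x j) \<le> (\<Sum>j\<in>J. nrm n (c j *\<^sub>s x j))"
    using assms by (intro nrm_sum X_scale) auto
  also have "\<dots> \<le> (\<Sum>j\<in>J. norm (c j) * b)"
    using assms by (intro sum_mono) (simp add: nrm_scale mult_left_mono)
  finally show ?thesis by (simp add: sum_distrib_right)
qed

text \<open>
  Truncated expansions approximate every element, and their finitely many entries can be moved into a
  countable dense set of scalars; finite lists over that set are countable. Each list is repeated for infinitely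
  many indices, so that approximations with arbitrarily large index exist.
\<close>
lemma dense_finite_sequences:
  "\<exists>(z :: nat \<Rightarrow> nat \<Rightarrow> 'k) d. (\<forall>i. \<forall>k>d i. z i k = 0) \<and>
    (\<forall>y\<in>X. \<forall>n\<ge>1. \<forall>r>0. \<forall>L. \<exists>i\<ge>L. nrm n (z i - y) < r)"
proof -
  obtain D :: "'k set" where D: "countable D" "\<And>U. open U \<Longrightarrow> U \<noteq> {} \<Longrightarrow> \<exists>d\<in>D. d \<in> U"
    using countable_dense_exists [where 'a = 'k] by blast
  define f where "f = from_nat_into (lists D)"
  have f: "range f = lists D"
    unfolding f_def using D by (intro range_from_nat_into countable_lists) auto
  define l where "l i = f (fst (prod_decode i))" for i
  define z where "z i k = (if k < length (l i) then l i ! k else 0)" for i k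
  show ?thesis
  proof (intro exI [of _ z] exI [of _ "\<lambda>i. length (l i)"] conjI allI ballI impI)
    show "z i k = 0" if "length (l i) < k" for i k using that by (simp add: z_def)
    fix y n r L assume y: "y \<in> X" and n: "(n::nat) \<ge> 1" and r: "(r::real) > 0"
    have "eventually (\<lambda>N. restr {..<N} y \<in> X \<and> nrm n (restr {..<N} y - y) < r / 2) sequentially"
      using expansion [OF y] n r unfolding limitin_T by (meson half_gt_zero)
    then obtain N where N: "nrm n (restr {..<N} y - y) < r / 2"
      using eventually_happens by fastforce
    define M where "M = (\<Sum>k<N. nrm n (unit_seq k)) + 1"
    have M: "M > 0" unfolding M_def using nrm_nonneg [OF n X_unit] by (simp add: sum_nonneg add_nonneg_pos)
    have "r / (2 * M) > 0" using r M by simp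
    then have "\<exists>a\<in>D. a \<in> ball (y k) (r / (2 * M))" for k
      by (intro D(2) open_ball) (simp add: not_le)
    then obtain g where g: "\<And>k. g k \<in> D" "\<And>k. dist (y k) (g k) < r / (2 * M)"
      unfolding mem_ball by metis
    have "map g [0..<N] \<in> range f" unfolding f using g(1) by auto
    then obtain a where a: "f a = map g [0..<N]" by (metis rangeE)
    \<comment> \<open>the second component of the pair only serves to make the index at least \<open>L\<close>\<close>
    define i where "i = prod_encode (a, L)"
    have zi: "z i = restr {..<N} g" by (auto simp: fun_eq_iff z_def l_def i_def a)
    have "z i - restr {..<N} y = restr {..<N} (\<lambda>k. g k - y k)" unfolding zi by (auto simp: fun_eq_iff)
    also have "\<dots> = (\<Sum>k<N. (g k - y k) *\<^sub>s unit_seq k)" by (simp add: sum_scaled_units)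
    finally have "nrm n (z i - restr {..<N} y) = nrm n (\<Sum>k<N. (g k - y k) *\<^sub>s unit_seq k)" by (rule arg_cong)
    also have "\<dots> \<le> (\<Sum>k<N. nrm n ((g k - y k) *\<^sub>s unit_seq k))"
      using n by (intro nrm_sum X_scale X_unit)
    also have "\<dots> \<le> (\<Sum>k<N. r / (2 * M) * nrm n (unit_seq k))"
    proof (intro sum_mono)
      fix k show "nrm n ((g k - y k) *\<^sub>s unit_seq k) \<le> r / (2 * M) * nrm n (unit_seq k)"
        unfolding nrm_scale [OF n X_unit] using g(2) [of k] nrm_nonneg [OF n X_unit]
        by (intro mult_right_mono) (auto simp: dist_norm norm_minus_commute)
    qed
    also have "\<dots> = r / (2 * M) * (M - 1)" by (simp add: M_def sum_distrib_left)
    also have "\<dots> \<le> r / 2" using M r by (simp add: field_simps)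
    finally have "nrm n (z i - restr {..<N} y) \<le> r / 2" .
    moreover have "nrm n (z i - y) \<le> nrm n (z i - restr {..<N} y) + nrm n (restr {..<N} y - y)"
      unfolding zi using n y by (intro nrm_triangle X_restr_finite) auto
    ultimately have "nrm n (z i - y) < r" using N by linarith
    moreover have "L \<le> i" by (simp add: i_def le_prod_encode_2)
    ultimately show "\<exists>i\<ge>L. nrm n (z i - y) < r" by blast
  qed
qed

end

section \<open>The weighted shift and the reduced condition\<close>

text \<open>
  The indices of the second series of condition (C): the elements of \<open>A\<close> after \<open>m\<close>, as seen from time
  \<open>m\<close> and moved by the offset \<open>j\<close>.
\<close>
definition shifted_tail :: "nat set \<Rightarrow> nat \<Rightarrow> nat \<Rightarrow> nat set"
  where "shifted_tail A m j = (\<lambda>n. n - m + j) ` {n \<in> A. m < n}"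

locale frechet_shift = frechet_seq_basis X nrm
  for X :: "(nat \<Rightarrow> 'k::{real_normed_field, euclidean_space}) set" and nrm +
  fixes w :: "nat \<Rightarrow> 'k"
  assumes w_nonzero: "\<forall>n\<ge>1. w n \<noteq> 0"
    and operator: "operator_on (seminorm_topology X nrm) (weighted_shift w)"
begin

abbreviation B where "B \<equiv> weighted_shift w"

text \<open>
  The coefficients along which the weighted shift becomes an unweighted one:
  \<open>B\<close> maps \<open>v (k + 1) e\<^sub>k\<^sub>+\<^sub>1\<close> to \<open>v k e\<^sub>k\<close>.
\<close>
definition v :: "nat \<Rightarrow> 'k" where "v k = 1 / (\<Prod>\<nu>=1..k. w \<nu>)"

text \<open>
  The formal series of all \<open>v k e\<^sub>k\<close> with \<open>k \<in> S\<close>, whether or not it belongs to \<open>X\<close>. Powers of the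
  shift act on it by translating \<open>S\<close> to the left.
\<close>
definition chi :: "nat set \<Rightarrow> nat \<Rightarrow> 'k" where "chi S = restr S v"

lemma chi_apply [simp]: "chi S k = (if k \<in> S then v k else 0)"
  by (simp add: chi_def)

lemma v_nonzero [simp]: "v k \<noteq> 0"
  using w_nonzero by (simp add: v_def)

lemma v_step: "v k = w (Suc k) * v (Suc k)"
  using w_nonzero by (simp add: v_def)

lemma B_pow_apply: "(B ^^ m) x k = v k / v (k + m) * x (k + m)"
proof (induction m arbitrary: k)
  case (Suc m)
  have "(B ^^ Suc m) x k = w (Suc k) * (v (Suc k) / v (Suc k + m) * x (Suc k + m))"
    using Suc by (simp add: weighted_shift_def [of w "(B ^^ m) x"])
  then show ?case by (simp add: v_step [of k])
qed simp

lemma B_pow_chi: "(B ^^ m) (chi S) = chi {k. k + m \<in> S}"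
  by (auto simp: fun_eq_iff B_pow_apply)

lemma B_pow_sum: "(B ^^ m) (\<Sum>i\<in>I. f i) = (\<Sum>i\<in>I. (B ^^ m) (f i))"
  by (auto simp: fun_eq_iff B_pow_apply sum_seq_apply sum_distrib_left)

lemma B_pow_scale: "(B ^^ m) (c *\<^sub>s x) = c *\<^sub>s (B ^^ m) x"
  by (auto simp: fun_eq_iff B_pow_apply)

lemma B_continuous: "continuous_map T T B"
  using operator by (simp add: operator_on_def)

lemma B_pow_continuous: "continuous_map T T (B ^^ m)"
proof (induction m)
  case 0 show ?case by (simp add: id_def)
next
  case (Suc m)
  then show ?case using continuous_map_compose [OF Suc B_continuous] by (simp add: comp_def)
qed

lemma B_pow_X: "x \<in> X \<Longrightarrow> (B ^^ m) x \<in> X"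
  using B_pow_continuous [of m] by (auto simp: continuous_map_def)

lemma shift_condition_iff:
  "shift_condition X nrm w \<A> \<epsilon> \<longleftrightarrow>
    (\<exists>A. (\<forall>p\<ge>1. A p \<in> \<A>) \<and> disjoint_family_on A {1..} \<and>
      (\<forall>p\<ge>1. chi ((\<lambda>n. n + p) ` A p) \<in> X) \<and>
      (\<forall>p\<ge>1. \<forall>q\<ge>1. \<forall>m\<in>A q. \<forall>j\<le>p. chi (shifted_tail (A p) m j) \<in> X \<and>
        nrm q (chi (shifted_tail (A p) m j)) < min (\<epsilon> p) (\<epsilon> q)))"
proof -
  have 1: "(\<exists>s. series_sums T (\<lambda>n. (1 / (\<Prod>\<nu>=1..n+p. w \<nu>)) *\<^sub>s unit_seq (n + p)) S s) \<longleftrightarrow>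
      chi ((\<lambda>n. n + p) ` S) \<in> X" for p S
    using series_sums_shifted_units [of S 0 v p] by (auto simp: v_def chi_def)
  have 2: "(\<exists>s. series_sums T (\<lambda>n. (1 / (\<Prod>\<nu>=1..n-m+j. w \<nu>)) *\<^sub>s unit_seq (n - m + j)) {n \<in> S. n > m} s
        \<and> nrm q s < b) \<longleftrightarrow>
      chi (shifted_tail S m j) \<in> X \<and> nrm q (chi (shifted_tail S m j)) < b" for m j S q b
    using series_sums_shifted_units [of "{n \<in> S. n > m}" m v j]
    by (auto simp: v_def chi_def shifted_tail_def)
  show ?thesis unfolding shift_condition_def 1 2 ..
qed

text \<open>
  Passing to a rapidly growing subsequence \<open>A (P i)\<close> strengthens every part of the condition at once. The
  offsets \<open>j\<close> may run up to \<open>P i\<close>, the seminorm has index \<open>P l\<close>, and the bounds are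
  \<open>\<epsilon> (P i)\<close> and \<open>\<epsilon> (P l)\<close>; so the offsets, the seminorms and the bounds can be prescribed in advance.
  Smaller offsets in the first series are reached by applying powers of the shift.
\<close>
lemma thin_out_shift_condition:
  fixes \<delta> :: "nat \<Rightarrow> real" and D :: "nat \<Rightarrow> nat"
  assumes C: "shift_condition X nrm w \<A> \<epsilon>" and \<epsilon>: "\<epsilon> \<longlonglongrightarrow> 0"
    and \<delta>: "\<And>i. \<delta> i > 0" and D: "\<And>i. D i \<ge> 1"
  shows "\<exists>A. (\<forall>i. A i \<in> \<A>) \<and> (\<forall>i l. i \<noteq> l \<longrightarrow> A i \<inter> A l = {}) \<and>
    (\<forall>i. \<forall>j\<le>D i. chi ((\<lambda>n. n + j) ` A i) \<in> X) \<and>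
    (\<forall>i l. \<forall>m\<in>A l. \<forall>j\<le>D i. chi (shifted_tail (A i) m j) \<in> X \<and>
        nrm (D l) (chi (shifted_tail (A i) m j)) < min (\<delta> i) (\<delta> l))"
proof -
  obtain A where A: "\<forall>p\<ge>1. A p \<in> \<A>" "disjoint_family_on A {1..}"
    and A1: "\<forall>p\<ge>1. chi ((\<lambda>n. n + p) ` A p) \<in> X"
    and A2: "\<forall>p\<ge>1. \<forall>q\<ge>1. \<forall>m\<in>A q. \<forall>j\<le>p. chi (shifted_tail (A p) m j) \<in> X \<and>
        nrm q (chi (shifted_tail (A p) m j)) < min (\<epsilon> p) (\<epsilon> q)"
    using C unfolding shift_condition_iff by (elim exE conjE) (rule that)
  have "\<exists>Q. \<forall>p\<ge>Q. \<epsilon> p < \<delta> i" for i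
    using order_tendstoD(2) [OF \<epsilon> \<delta> [of i]] by (simp add: eventually_sequentially)
  then obtain Q where Q: "\<And>i p. p \<ge> Q i \<Longrightarrow> \<epsilon> p < \<delta> i" by metis
  \<comment> \<open>strictly increasing and above both \<open>D\<close> and \<open>Q\<close>\<close>
  define P where "P i = (\<Sum>l\<le>i. D l + Q l)" for i :: nat
  have P: "D i \<le> P i" "Q i \<le> P i" "1 \<le> P i" for i
  proof -
    have "D i + Q i \<le> P i" unfolding P_def by (rule member_le_sum) auto
    then show "D i \<le> P i" "Q i \<le> P i" "1 \<le> P i" using D [of i] by auto
  qed
  have "strict_mono P"
    unfolding strict_mono_Suc_iff P_def using D by (auto simp: Suc_le_eq)
  then have inj: "P i \<noteq> P l" if "i \<noteq> l" for i l using that by (simp add: strict_mono_eq)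
  show ?thesis
  proof (intro exI [of _ "\<lambda>i. A (P i)"] conjI allI impI ballI)
    show "A (P i) \<in> \<A>" for i using A(1) P by blast
    show "A (P i) \<inter> A (P l) = {}" if "i \<noteq> l" for i l
      using A(2) P(3) inj [OF that] unfolding disjoint_family_on_def by simp
    show "chi ((\<lambda>n. n + j) ` A (P i)) \<in> X" if "j \<le> D i" for i j
    proof -
      have j: "j \<le> P i" using that P(1) [of i] by simp
      have "{k. k + (P i - j) \<in> (\<lambda>n. n + P i) ` A (P i)} = (\<lambda>n. n + j) ` A (P i)"
      proof (intro set_eqI iffI; clarsimp)
        fix k n assume "k + (P i - j) = n + P i" "n \<in> A (P i)"
        moreover from this have "k = n + j" using j by linarith
        ultimately show "k \<in> (\<lambda>n. n + j) ` A (P i)" by blast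
      next
        fix n assume "n \<in> A (P i)"
        moreover have "n + j + (P i - j) = n + P i" using j by simp
        ultimately show "n + j + (P i - j) \<in> (\<lambda>n. n + P i) ` A (P i)" by simp
      qed
      then have "chi ((\<lambda>n. n + j) ` A (P i)) = (B ^^ (P i - j)) (chi ((\<lambda>n. n + P i) ` A (P i)))"
        by (simp add: B_pow_chi)
      then show ?thesis using B_pow_X A1 P(3) by simp
    qed
    fix i l m j assume m: "m \<in> A (P l)" and j: "j \<le> D i"
    have *: "chi (shifted_tail (A (P i)) m j) \<in> X \<and>
        nrm (P l) (chi (shifted_tail (A (P i)) m j)) < min (\<epsilon> (P i)) (\<epsilon> (P l))"
      using A2 P(3) m order_trans [OF j P(1)] by blast
    then show "chi (shifted_tail (A (P i)) m j) \<in> X" by blast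
    have "nrm (D l) (chi (shifted_tail (A (P i)) m j)) \<le> nrm (P l) (chi (shifted_tail (A (P i)) m j))"
      using * D P by (intro nrm_mono) auto
    with * Q [OF P(2), of i] Q [OF P(2), of l]
    show "nrm (D l) (chi (shifted_tail (A (P i)) m j)) < min (\<delta> i) (\<delta> l)" by auto
  qed
qed

lemma shift_condition_any_null_seq:
  assumes "shift_condition X nrm w \<A> \<epsilon>" "positive_null_seq \<epsilon>" "positive_null_seq \<delta>"
  shows "shift_condition X nrm w \<A> \<delta>"
proof -
  have pos: "\<And>i. (if i = 0 then 1 else \<delta> i) > 0" and D: "\<And>i::nat. 1 \<le> max 1 i"
    using assms by (auto simp: positive_null_seq_def)
  have lim: "\<epsilon> \<longlonglongrightarrow> 0" using assms(2) by (simp add: positive_null_seq_def)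
  obtain A where A: "\<forall>i. A i \<in> \<A>" and disj: "\<forall>i l. i \<noteq> l \<longrightarrow> A i \<inter> A l = {}"
    and A1: "\<forall>i. \<forall>j\<le>max 1 i. chi ((\<lambda>n. n + j) ` A i) \<in> X"
    and A2: "\<forall>i l. \<forall>m\<in>A l. \<forall>j\<le>max 1 i. chi (shifted_tail (A i) m j) \<in> X \<and>
        nrm (max 1 l) (chi (shifted_tail (A i) m j)) <
          min (if i = 0 then 1 else \<delta> i) (if l = 0 then 1 else \<delta> l)"
    using thin_out_shift_condition [where \<delta> = "\<lambda>i. if i = 0 then 1 else \<delta> i" and D = "\<lambda>i. max 1 i",
          OF assms(1) lim pos D] by (elim exE conjE) (rule that)
  have "disjoint_family_on A {1..}" using disj by (simp add: disjoint_family_on_def)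
  moreover have "chi (shifted_tail (A p) m j) \<in> X \<and> nrm q (chi (shifted_tail (A p) m j)) < min (\<delta> p) (\<delta> q)"
    if "p \<ge> 1" "q \<ge> 1" "m \<in> A q" "j \<le> p" for p q m j
    using A2 [rule_format, of m q j p] that by (simp add: max_absorb2)
  ultimately show ?thesis unfolding shift_condition_iff using A A1 by (intro exI [of _ A]) auto
qed

section \<open>The condition implies hypercyclicity\<close>

text \<open>
  The vector is \<open>x = \<Sum>\<^sub>i u\<^sub>i\<close>, where \<open>u\<^sub>i\<close> is the sum over \<open>n \<in> A\<^sub>i\<close> of preimages under
  \<open>B\<^sup>n\<close> of a finitely supported sequence \<open>z\<^sub>i\<close>, the \<open>z\<^sub>i\<close> being dense. For \<open>m \<in> A\<^sub>l\<close> the vector \<open>B\<^sup>m x\<close> splits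
  into three parts. The summand with \<open>n = m\<close> contributes exactly \<open>z\<^sub>l\<close>. The summands with \<open>n > m\<close> are the
  series of the condition and hence small. The summands with \<open>n < m\<close> vanish, because the gap \<open>m - n\<close>
  exceeds the length of \<open>z\<^sub>i\<close>: otherwise the series of the condition for \<open>A\<^sub>l\<close> seen from \<open>n\<close> would have
  \<open>v (m - n)\<close> as a coordinate, which is too large for its norm.
\<close>
lemma hypercyclic_if_shift_condition:
  assumes C: "shift_condition X nrm w \<A> \<epsilon>" and null: "positive_null_seq \<epsilon>"
    and fam: "furstenberg_family \<A>"
  shows "hypercyclic_wrt \<A> T B"
proof (cases "{} \<in> \<A>")
  case True
  then have "S \<in> \<A>" for S using fam unfolding furstenberg_family_def by (meson empty_subsetI)
  then show ?thesis unfolding hypercyclic_wrt_def using B_continuous X_zero by auto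
next
  case False
  obtain z :: "nat \<Rightarrow> nat \<Rightarrow> 'k" and d where z0: "\<forall>i. \<forall>k>d i. z i k = 0"
    and dense: "\<forall>y\<in>X. \<forall>n\<ge>1. \<forall>r>0. \<forall>L. \<exists>i\<ge>L. nrm n (z i - y) < r"
    using dense_finite_sequences by (elim exE conjE) (rule that)
  have "\<exists>Q\<ge>1. \<exists>R>0. \<forall>x\<in>X. nrm Q x < R \<longrightarrow> (\<forall>k\<le>d i. norm (x k) < norm (v k))" for i
    by (intro coords_small) simp
  then obtain Q R where Q: "\<And>i. Q i \<ge> 1" and R: "\<And>i. R i > 0"
    and QR: "\<And>i x k. x \<in> X \<Longrightarrow> nrm (Q i) x < R i \<Longrightarrow> k \<le> d i \<Longrightarrow> norm (x k) < norm (v k)"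
    by metis
  define c where "c i j = z i j / v j" for i j
  define c1 where "c1 i = (\<Sum>j\<le>d i. norm (c i j))" for i
  \<comment> \<open>the summand \<open>d i\<close> lets the offsets cover the support of \<open>z i\<close>, the summand \<open>Q i\<close> serves the gaps,
    and the summand \<open>i\<close> leaves room for an additional offset \<open>m \<le> i\<close> and makes \<open>nrm (D i)\<close> at least
    as strong as \<open>nrm i\<close>\<close>
  define D where "D i = i + d i + Q i" for i
  \<comment> \<open>below \<open>R i\<close> for the gaps, and so small that the sums of \<open>c1 i * min (\<delta> i) (\<delta> l)\<close> over all \<open>i\<close> tend
    to \<open>0\<close> as \<open>l\<close> grows\<close>
  define \<delta> where "\<delta> i = min (R i) ((1/2) ^ i / (1 + (\<Sum>l\<le>i. c1 l)))" for i
  have c1: "c1 i \<ge> 0" for i by (simp add: c1_def sum_nonneg)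
  have \<delta>: "\<delta> i > 0" for i using R by (simp add: \<delta>_def c1 sum_nonneg add_pos_nonneg)
  have D: "D i \<ge> 1" for i using Q [of i] by (simp add: D_def)
  have c1sum: "(\<Sum>l\<le>i. c1 l) * \<delta> i \<le> (1/2) ^ i" for i
  proof -
    let ?s = "\<Sum>l\<le>i. c1 l"
    have s: "?s \<ge> 0" by (simp add: c1 sum_nonneg)
    then have "?s * \<delta> i \<le> ?s * ((1/2) ^ i / (1 + ?s))"
      by (intro mult_left_mono) (simp_all add: \<delta>_def)
    also have "\<dots> = (1/2) ^ i * (?s / (1 + ?s))" by simp
    also have "\<dots> \<le> (1/2) ^ i * 1" using s by (intro mult_left_mono) simp_all
    also have "\<dots> = (1/2) ^ i" by simp
    finally show ?thesis .
  qed
  have c1\<delta>: "c1 i * \<delta> i \<le> (1/2) ^ i" for i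
  proof -
    have "c1 i \<le> (\<Sum>l\<le>i. c1 l)" by (rule member_le_sum) (use c1 in auto)
    then have "c1 i * \<delta> i \<le> (\<Sum>l\<le>i. c1 l) * \<delta> i" using \<delta> [of i] by (intro mult_right_mono) auto
    with c1sum show ?thesis by (rule order_trans [rotated])
  qed
  have lim: "\<epsilon> \<longlonglongrightarrow> 0" using null by (simp add: positive_null_seq_def)
  obtain A where A: "\<forall>i. A i \<in> \<A>" and disj: "\<forall>i l. i \<noteq> l \<longrightarrow> A i \<inter> A l = {}"
    and A1: "\<forall>i. \<forall>j\<le>D i. chi ((\<lambda>n. n + j) ` A i) \<in> X"
    and A2: "\<forall>i l. \<forall>m\<in>A l. \<forall>j\<le>D i. chi (shifted_tail (A i) m j) \<in> X \<and>
        nrm (D l) (chi (shifted_tail (A i) m j)) < min (\<delta> i) (\<delta> l)"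
    using thin_out_shift_condition [where \<delta> = \<delta> and D = D, OF C lim \<delta> D] by (elim exE conjE) (rule that)
  have ne: "A i \<noteq> {}" for i using A False by metis
  have dD: "j \<le> D i" if "j \<le> d i" for i j using that by (simp add: D_def)

  have gap: "d i < m - n" if n: "n \<in> A i" and m: "m \<in> A l" and less: "n < m" for i l n m
  proof (rule ccontr)
    assume "\<not> d i < m - n"
    let ?s = "chi (shifted_tail (A l) n 0)"
    have s: "?s \<in> X" "nrm (D i) ?s < min (\<delta> l) (\<delta> i)" using A2 n by blast+
    have "nrm (Q i) ?s \<le> nrm (D i) ?s" using s Q by (intro nrm_mono) (auto simp: D_def)
    then have "nrm (Q i) ?s < R i" using s(2) by (simp add: \<delta>_def)
    then have "norm (?s (m - n)) < norm (v (m - n))"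
      by (rule QR [OF s(1)]) (use \<open>\<not> d i < m - n\<close> in simp)
    moreover have "m - n \<in> shifted_tail (A l) n 0" using m less by (auto simp: shifted_tail_def)
    ultimately show False by simp
  qed

  define u where "u i = (\<Sum>j\<le>d i. c i j *\<^sub>s chi ((\<lambda>n. n + j) ` A i))" for i
  define t where "t i m = (\<Sum>j\<le>d i. c i j *\<^sub>s chi (shifted_tail (A i) m j))" for i m
  have uX: "u i \<in> X" for i
    unfolding u_def using A1 dD by (intro X_sum X_scale) auto
  have tX: "t i m \<in> X" if "m \<in> A l" for i l m
    unfolding t_def using A2 dD that by (intro X_sum X_scale) blast
  have t_le: "nrm (D l) (t i m) \<le> c1 i * min (\<delta> i) (\<delta> l)" if "m \<in> A l" for i l m
    unfolding t_def c1_def using A2 dD that D by (intro nrm_combination_le) (auto intro: less_imp_le)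

  have zX: "z i \<in> X" for i
  proof -
    have "z i = restr {..d i} (z i)" using z0 by (auto simp: fun_eq_iff not_le)
    then show ?thesis using X_restr_finite [of "{..d i}" "z i"] by simp
  qed
  have shift_u: "(B ^^ m) (u i) = (if i = l then z l else 0) + t i m" if m: "m \<in> A l" for i l m
  proof
    fix k
    have mem: "k + m \<in> (\<lambda>n. n + j) ` A i \<longleftrightarrow> (i = l \<and> k = j) \<or> k \<in> shifted_tail (A i) m j"
      (is "?L \<longleftrightarrow> ?R") if j: "j \<le> d i" for j
    proof
      assume ?L
      then obtain n where n: "n \<in> A i" "k + m = n + j" by auto
      consider "n < m" | "n = m" | "n > m" by linarith
      then show ?R
      proof cases
        case 1 then show ?thesis using gap [OF n(1) m 1] n j by linarith
      next
        case 2 then show ?thesis using n m disj by auto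
      next
        case 3
        moreover have "k = n - m + j" using n 3 by linarith
        ultimately show ?thesis using n by (auto simp: shifted_tail_def)
      qed
    next
      assume ?R
      then show ?L
      proof
        assume "i = l \<and> k = j" then show ?L using m by auto
      next
        assume "k \<in> shifted_tail (A i) m j"
        then obtain n where "n \<in> A i" "m < n" "k = n - m + j" by (auto simp: shifted_tail_def)
        then show ?L by (intro image_eqI [of _ _ n]) auto
      qed
    qed
    have "k \<notin> shifted_tail (A i) m k" by (auto simp: shifted_tail_def)
    then have split: "c i j * chi {k. k + m \<in> (\<lambda>n. n + j) ` A i} k =
        (if k = j then (if i = l then z l k else 0) else 0) + c i j * chi (shifted_tail (A i) m j) k"
      if "j \<le> d i" for j
      using mem [OF that] by (auto simp: c_def)
    have "(B ^^ m) (u i) k = (\<Sum>j\<le>d i. c i j * chi {k. k + m \<in> (\<lambda>n. n + j) ` A i} k)"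
      by (simp only: u_def B_pow_sum B_pow_scale B_pow_chi sum_seq_apply scale_apply)
    also have "\<dots> = (\<Sum>j\<le>d i. (if k = j then (if i = l then z l k else 0) else 0)
        + c i j * chi (shifted_tail (A i) m j) k)"
      by (intro sum.cong refl split) simp
    also have "\<dots> = (\<Sum>j\<le>d i. if k = j then (if i = l then z l k else 0) else 0) + t i m k"
      by (simp only: sum.distrib t_def sum_seq_apply scale_apply)
    also have "(\<Sum>j\<le>d i. if k = j then (if i = l then z l k else 0) else 0) = (if i = l then z l else 0) k"
      using z0 by auto
    finally show "(B ^^ m) (u i) k = ((if i = l then z l else 0) + t i m) k" by simp
  qed

  \<comment> \<open>The condition only bounds series that have been shifted by some \<open>m \<in> A q\<close>. Fixing such an \<open>m\<close> and
    using the offset \<open>j + m\<close> undoes the shift; the restriction to \<open>n > m\<close> is void for large \<open>i\<close> because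
    the disjoint sets \<open>A i\<close> eventually avoid \<open>{..m}\<close>.\<close>
  have u_small: "eventually (\<lambda>i. nrm q (u i) \<le> (1/2) ^ i) sequentially" if q: "q \<ge> 1" for q
  proof -
    obtain m where m: "m \<in> A q" using ne by blast
    have "eventually (\<lambda>i. n \<notin> A i) sequentially" for n
    proof (cases "\<exists>i. n \<in> A i")
      case True
      then obtain i where i: "n \<in> A i" by blast
      have "n \<notin> A l" if "l > i" for l using disj that i by (metis disjoint_iff less_irrefl)
      then show ?thesis by (rule eventually_mono [OF eventually_gt_at_top [of i]])
    qed simp
    then have "eventually (\<lambda>i. \<forall>n\<in>{..m}. n \<notin> A i) sequentially"
      by (intro eventually_ball_finite) auto
    then show ?thesis using eventually_ge_at_top [of m]
    proof eventually_elim
      case (elim i)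
      have big: "m < n" if "n \<in> A i" for n using elim(1) that not_le by auto
      have "chi ((\<lambda>n. n + j) ` A i) \<in> X \<and> nrm q (chi ((\<lambda>n. n + j) ` A i)) \<le> \<delta> i" if "j \<le> d i" for j
      proof -
        have "n - m + (j + m) = n + j" if "n \<in> A i" for n using big [OF that] by simp
        then have eq: "(\<lambda>n. n + j) ` A i = shifted_tail (A i) m (j + m)"
          unfolding shifted_tail_def using big by (intro image_cong) auto
        have "j + m \<le> D i" using that elim(2) by (simp add: D_def)
        then have *: "chi ((\<lambda>n. n + j) ` A i) \<in> X" "nrm (D q) (chi ((\<lambda>n. n + j) ` A i)) < min (\<delta> i) (\<delta> q)"
          unfolding eq using A2 m by blast+
        moreover have "nrm q (chi ((\<lambda>n. n + j) ` A i)) \<le> nrm (D q) (chi ((\<lambda>n. n + j) ` A i))"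
          using q * by (intro nrm_mono) (auto simp: D_def)
        ultimately show ?thesis by simp
      qed
      then have "nrm q (u i) \<le> c1 i * \<delta> i"
        unfolding u_def c1_def using q by (intro nrm_combination_le) auto
      with c1\<delta> [of i] show ?case by (rule order_trans [rotated])
    qed
  qed
  have "\<exists>x. limitin T (\<lambda>N. \<Sum>i<N. u i) x sequentially"
  proof (rule series_converges)
    show "summable (\<lambda>i. nrm q (u i))" if q: "q \<ge> 1" for q
    proof (rule summable_comparison_test_ev)
      show "eventually (\<lambda>i. norm (nrm q (u i)) \<le> (1/2) ^ i) sequentially"
        using u_small [OF q] by (simp add: nrm_nonneg [OF q uX])
    qed (simp add: summable_geometric)
  qed (use uX in auto)
  then obtain x where x: "limitin T (\<lambda>N. \<Sum>i<N. u i) x sequentially" by blast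
  then have xX: "x \<in> X" by (simp add: limitin_T)

  have close: "nrm (D l) ((B ^^ m) x - z l) \<le> 2 * (1/2) ^ l" if m: "m \<in> A l" for l m
  proof (rule nrm_limit_le)
    show "limitin T (\<lambda>N. (B ^^ m) (\<Sum>i<N. u i)) ((B ^^ m) x) sequentially"
      using continuous_map_limit [OF B_pow_continuous x] by (simp add: o_def)
    \<comment> \<open>terms up to \<open>l\<close> are at most \<open>c1 i * \<delta> l\<close>, later ones at most \<open>(1/2) ^ i\<close>; the subtracted power makes
      the induction work\<close>
    have bound: "(\<Sum>i<N. c1 i * min (\<delta> i) (\<delta> l)) \<le> 2 * (1/2) ^ l - (1/2) ^ (N - 1)" if "Suc l \<le> N" for N
      using that
    proof (induction N rule: dec_induct)
      case base
      have "(\<Sum>i<Suc l. c1 i * min (\<delta> i) (\<delta> l)) \<le> (\<Sum>i\<le>l. c1 i * \<delta> l)"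
        unfolding lessThan_Suc_atMost using c1 by (intro sum_mono mult_left_mono) auto
      also have "\<dots> \<le> (1/2) ^ l" using c1sum [of l] by (simp add: sum_distrib_right)
      finally show ?case by simp
    next
      case (step N)
      have "c1 N * min (\<delta> N) (\<delta> l) \<le> c1 N * \<delta> N" using c1 by (intro mult_left_mono) auto
      also have "\<dots> \<le> (1/2) ^ N" by (rule c1\<delta>)
      finally have "(\<Sum>i<Suc N. c1 i * min (\<delta> i) (\<delta> l)) \<le> 2 * (1/2) ^ l - (1/2) ^ (N - 1) + (1/2) ^ N"
        using step.IH by simp
      moreover have "(1/2::real) ^ (N - 1) = 2 * (1/2) ^ N" using step.hyps by (cases N) auto
      ultimately show ?case by simp
    qed
    show "eventually (\<lambda>N. nrm (D l) ((B ^^ m) (\<Sum>i<N. u i) - z l) \<le> 2 * (1/2) ^ l) sequentially"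
      using eventually_gt_at_top [of l]
    proof eventually_elim
      case (elim N)
      have "(B ^^ m) (\<Sum>i<N. u i) = (\<Sum>i<N. if i = l then z l else 0) + (\<Sum>i<N. t i m)"
        unfolding B_pow_sum shift_u [OF m] by (rule sum.distrib)
      also have "(\<Sum>i<N. if i = l then z l else 0) = z l" using elim by simp
      finally have "(B ^^ m) (\<Sum>i<N. u i) - z l = (\<Sum>i<N. t i m)" by (simp only: add_diff_cancel_left')
      then have "nrm (D l) ((B ^^ m) (\<Sum>i<N. u i) - z l) = nrm (D l) (\<Sum>i<N. t i m)" by (rule arg_cong)
      also have "\<dots> \<le> (\<Sum>i<N. nrm (D l) (t i m))" using D tX m by (intro nrm_sum) blast+
      also have "\<dots> \<le> (\<Sum>i<N. c1 i * min (\<delta> i) (\<delta> l))" by (intro sum_mono t_le m)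
      also have "\<dots> \<le> 2 * (1/2) ^ l - (1/2) ^ (N - 1)" by (rule bound [OF Suc_leI [OF elim]])
      also have "\<dots> \<le> 2 * (1/2) ^ l" by simp
      finally show ?case .
    qed
  qed (use D zX in auto)

  have "{n. (B ^^ n) x \<in> U} \<in> \<A>" if U: "openin T U" "U \<noteq> {}" for U
  proof -
    obtain y where y: "y \<in> U" using U by blast
    then obtain q r where q: "q \<ge> 1" "r > 0" "{x \<in> X. nrm q (x - y) < r} \<subseteq> U"
      using U openin_T by blast
    have yX: "y \<in> X" using U y openin_T by blast
    have "eventually (\<lambda>l. 2 * (1/2::real) ^ l < r / 2) sequentially"
      using q(2) by (intro order_tendstoD(2) [of _ 0] tendsto_mult_right_zero LIMSEQ_power_zero) auto
    then obtain L where L: "\<And>l. l \<ge> L \<Longrightarrow> 2 * (1/2::real) ^ l < r / 2"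
      unfolding eventually_sequentially by blast
    \<comment> \<open>density supplies an index that is also large, which both \<open>close\<close> and the passage to \<open>nrm (D l)\<close> need\<close>
    obtain l where l: "l \<ge> max L q" "nrm q (z l - y) < r / 2"
      using dense [rule_format, OF yX q(1), of "r / 2" "max L q"] q(2) by auto
    have "(B ^^ m) x \<in> U" if m: "m \<in> A l" for m
    proof -
      have BX: "(B ^^ m) x \<in> X" by (rule B_pow_X [OF xX])
      have "nrm q ((B ^^ m) x - z l) \<le> nrm (D l) ((B ^^ m) x - z l)"
        using l q BX zX by (intro nrm_mono X_diff) (auto simp: D_def)
      also have "\<dots> < r / 2" using close [OF m] L [of l] l by simp
      finally have "nrm q ((B ^^ m) x - y) < r"
        using nrm_triangle [OF q(1) BX zX yX, of l] l(2) by linarith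
      then show ?thesis using q(3) BX by blast
    qed
    then have "A l \<subseteq> {n. (B ^^ n) x \<in> U}" by blast
    then show ?thesis using fam A unfolding furstenberg_family_def by blast
  qed
  then show ?thesis unfolding hypercyclic_wrt_def using B_continuous xX by auto
qed

end

section \<open>Unconditional bases\<close>

lemma block_permutation:
  fixes b :: "nat \<Rightarrow> nat"
  assumes b: "strict_mono b" "b 0 = 0"
    and g: "\<And>i. bij_betw (g i) {b i..<b (Suc i)} {b i..<b (Suc i)}"
  shows "\<exists>\<pi>. bij \<pi> \<and> (\<forall>i. \<forall>n\<in>{b i..<b (Suc i)}. \<pi> n = g i n)"
proof -
  let ?I = "\<lambda>i. {b i..<b (Suc i)}"
  have step: "b i < b (Suc i)" for i using b by (simp add: strict_mono_less)
  have cover: "\<exists>i. n \<in> ?I i" for n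
  proof (induction n)
    case 0
    then show ?case using step [of 0] b by (intro exI [of _ 0]) simp
  next
    case (Suc n)
    then obtain i where i: "n \<in> ?I i" by blast
    show ?case
    proof (cases "Suc n < b (Suc i)")
      case True then show ?thesis using i by (intro exI [of _ i]) simp
    next
      case False then show ?thesis using i step [of "Suc i"] by (intro exI [of _ "Suc i"]) simp
    qed
  qed
  have disj: "?I i \<inter> ?I l = {}" if "i < l" for i l
  proof -
    have "b (Suc i) \<le> b l" using b that by (simp add: strict_mono_less_eq)
    then show ?thesis by auto
  qed
  have uniq: "i = l" if "n \<in> ?I i" "n \<in> ?I l" for n i l
    using disj [of i l] disj [of l i] that by (meson disjoint_iff linorder_neqE_nat)
  define \<pi> where "\<pi> n = g (THE i. n \<in> ?I i) n" for n
  have \<pi>: "\<pi> n = g i n" if "n \<in> ?I i" for i n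
  proof -
    have "(THE i. n \<in> ?I i) = i" using that uniq by (intro the_equality) blast+
    then show ?thesis by (simp add: \<pi>_def)
  qed
  have "bij_betw \<pi> (\<Union>i\<in>UNIV. ?I i) (\<Union>i\<in>UNIV. ?I i)"
  proof (rule bij_betw_UNION_disjoint)
    show "disjoint_family_on ?I UNIV" unfolding disjoint_family_on_def using uniq by blast
    show "bij_betw \<pi> (?I i) (?I i)" for i using g [of i] bij_betw_cong [of "?I i" \<pi> "g i"] \<pi> by blast
  qed
  moreover have "(\<Union>i\<in>UNIV. ?I i) = UNIV" using cover by blast
  ultimately have "bij \<pi>" by (simp only:)
  then show ?thesis using \<pi> by blast
qed

context frechet_seq_basis
begin

text \<open>
  If finite sets of arbitrarily large indices carried a partial sum of norm at least \<open>e\<close>, they could be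
  chosen in successive disjoint intervals. Permuting each interval so that its finite set comes first
  gives a rearrangement of the expansion whose partial sums are not Cauchy.
\<close>
lemma unconditional_finite_tails:
  assumes U: "unconditional_basis_of T unit_seq" and x: "x \<in> X" and q: "q \<ge> 1" and e: "e > 0"
  shows "\<exists>N. \<forall>F. finite F \<longrightarrow> F \<subseteq> {N..} \<longrightarrow> nrm q (restr F x) < e"
proof (rule ccontr)
  assume "\<not> ?thesis"
  then have "\<forall>N. \<exists>F. finite F \<and> F \<subseteq> {N..} \<and> e \<le> nrm q (restr F x)" by (meson not_le)
  then obtain G where fin: "\<And>N. finite (G N)" and GN: "\<And>N. G N \<subseteq> {N..}"
    and big: "\<And>N. e \<le> nrm q (restr (G N) x)" by metis
  define b where "b = rec_nat 0 (\<lambda>_ m. Suc (Max (insert m (G m))))"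
  have b0: "b 0 = 0" and bSuc: "b (Suc i) = Suc (Max (insert (b i) (G (b i))))" for i
    by (simp_all add: b_def)
  have "b i < b (Suc i)" for i unfolding bSuc using fin by (simp add: less_Suc_eq_le)
  then have mono: "strict_mono b" by (simp add: strict_mono_Suc_iff)
  have block: "G (b i) \<subseteq> {b i..<b (Suc i)}" for i
  proof
    fix n assume n: "n \<in> G (b i)"
    then have "n \<le> Max (insert (b i) (G (b i)))" using fin by (intro Max_ge) auto
    then show "n \<in> {b i..<b (Suc i)}" using n GN [of "b i"] unfolding bSuc by auto
  qed
  define a where "a i = b i + card (G (b i))" for i
  have a: "b i \<le> a i" "a i \<le> b (Suc i)" for i
  proof -
    have "card (G (b i)) \<le> card {b i..<b (Suc i)}" by (rule card_mono) (use block in auto)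
    then show "b i \<le> a i" "a i \<le> b (Suc i)"
      using strict_mono_less [OF mono, of i "Suc i"] by (auto simp: a_def)
  qed
  have "\<exists>g. bij_betw g {b i..<b (Suc i)} {b i..<b (Suc i)} \<and> g ` {b i..<a i} = G (b i)" for i
  proof -
    let ?R = "{b i..<b (Suc i)} - G (b i)"
    have "card {b i..<a i} = card (G (b i))" by (simp add: a_def)
    then obtain h1 where h1: "bij_betw h1 {b i..<a i} (G (b i))"
      using finite_same_card_bij [of "{b i..<a i}" "G (b i)"] fin by blast
    have "card ?R = b (Suc i) - b i - card (G (b i))"
      using block fin by (simp add: card_Diff_subset)
    then have "card {a i..<b (Suc i)} = card ?R" by (simp add: a_def)
    then obtain h2 where h2: "bij_betw h2 {a i..<b (Suc i)} ?R"
      using finite_same_card_bij [of "{a i..<b (Suc i)}" ?R] by blast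
    let ?h = "\<lambda>n. if n \<in> {b i..<a i} then h1 n else h2 n"
    have "bij_betw ?h ({b i..<a i} \<union> {a i..<b (Suc i)}) (G (b i) \<union> ?R)"
      by (rule bij_betw_disjoint_Un [OF h1 h2]) auto
    moreover have "{b i..<a i} \<union> {a i..<b (Suc i)} = {b i..<b (Suc i)}"
      using a [of i] by (simp add: ivl_disj_un)
    moreover have "G (b i) \<union> ?R = {b i..<b (Suc i)}" using block [of i] by blast
    moreover have "?h ` {b i..<a i} = G (b i)" using h1 by (simp add: bij_betw_def)
    ultimately show ?thesis by (intro exI [of _ ?h]) (simp only:)
  qed
  then obtain g where g: "\<And>i. bij_betw (g i) {b i..<b (Suc i)} {b i..<b (Suc i)}"
    and gG: "\<And>i. g i ` {b i..<a i} = G (b i)" by metis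
  obtain \<pi> where \<pi>: "bij \<pi>" and \<pi>g: "\<forall>i. \<forall>n\<in>{b i..<b (Suc i)}. \<pi> n = g i n"
    using block_permutation [OF mono b0 g] by blast
  have im: "\<pi> ` {b i..<a i} = G (b i)" for i
  proof -
    have "\<pi> ` {b i..<a i} = g i ` {b i..<a i}"
      using \<pi>g a(2) [of i] by (intro image_cong) auto
    then show ?thesis by (simp add: gG)
  qed
  have "series_sums T (\<lambda>n. x n *\<^sub>s unit_seq n) UNIV x"
    using expansion [OF x] by (simp add: series_sums_def sum_scaled_units)
  then obtain s where s: "series_sums T (\<lambda>n. x (\<pi> n) *\<^sub>s unit_seq (\<pi> n)) UNIV s"
    using U x \<pi> unfolding unconditional_basis_of_def topspace_T by blast
  define P where "P N = (\<Sum>n<N. x (\<pi> n) *\<^sub>s unit_seq (\<pi> n) :: nat \<Rightarrow> 'k)" for N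
  have PX: "P N \<in> X" for N unfolding P_def by (intro X_sum X_scale X_unit)
  have lim: "limitin T P s sequentially" using s by (simp add: series_sums_def P_def [abs_def])
  then have sX: "s \<in> X" by (simp add: limitin_T)
  have "eventually (\<lambda>N. P N \<in> X \<and> nrm q (P N - s) < e / 2) sequentially"
    using lim q e unfolding limitin_T by (meson half_gt_zero)
  then obtain i where i: "\<And>N. N \<ge> i \<Longrightarrow> nrm q (P N - s) < e / 2"
    unfolding eventually_sequentially by blast
  have "i \<le> b i" using mono by (rule strict_mono_imp_increasing)
  then have "nrm q (P (a i) - s) < e / 2" "nrm q (P (b i) - s) < e / 2" using i a(1) [of i] by auto
  then have "nrm q (P (a i) - P (b i)) < e"
    using nrm_triangle [OF q PX sX PX, of "a i" "b i"] nrm_minus_commute [OF q sX PX, of "b i"] by simp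
  moreover have "P (a i) - P (b i) = restr (G (b i)) x"
  proof -
    have "P (a i) - P (b i) = (\<Sum>n\<in>{b i..<a i}. x (\<pi> n) *\<^sub>s unit_seq (\<pi> n))"
      unfolding P_def lessThan_atLeast0 using a(1) [of i] by (intro sum_diff_nat_ivl) auto
    also have "\<dots> = (\<Sum>k\<in>\<pi> ` {b i..<a i}. x k *\<^sub>s unit_seq k)"
      using \<pi> by (subst sum.reindex) (auto simp: bij_def inj_on_def)
    also have "\<dots> = restr (G (b i)) x" unfolding im using fin by (rule sum_scaled_units)
    finally show ?thesis .
  qed
  ultimately show False using big [of "b i"] by simp
qed

lemma finite_part_le:
  assumes "n \<ge> 1" "finite F"
  shows "nrm n (restr F y) \<le> (\<Sum>k\<in>F. norm (y k) * nrm n (unit_seq k))"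
  unfolding sum_scaled_units [OF assms(2), symmetric]
  using nrm_sum [OF assms(1), of F "\<lambda>k. y k *\<^sub>s unit_seq k"] X_scale [OF X_unit]
  by (simp add: nrm_scale [OF assms(1) X_unit])

text \<open>
  Finitely many coordinates form a continuous part of a sequence: the parts supported below a fixed
  index are uniformly small near the origin.
\<close>
lemma head_small:
  assumes p: "p \<ge> 1" and a: "a > 0"
  shows "\<exists>n\<ge>1. \<exists>r>0. \<forall>y\<in>X. nrm n y < r \<longrightarrow> (\<forall>F\<subseteq>{..<M}. nrm p (restr F y) < a)"
proof -
  define K where "K = (\<Sum>k<M. nrm p (unit_seq k))"
  have K: "K \<ge> 0" unfolding K_def using nrm_nonneg [OF p X_unit] by (simp add: sum_nonneg)
  obtain n r where n: "n \<ge> 1" "r > 0" "\<forall>y\<in>X. nrm n y < r \<longrightarrow> (\<forall>k\<le>M. norm (y k) < a / (K + 1))"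
    using coords_small [of M "\<lambda>_. a / (K + 1)"] a K by auto
  have "nrm p (restr F y) < a" if y: "y \<in> X" "nrm n y < r" and F: "F \<subseteq> {..<M}" for F y
  proof -
    have fin: "finite F" using F finite_subset by blast
    have "nrm p (restr F y) \<le> (\<Sum>k\<in>F. norm (y k) * nrm p (unit_seq k))"
      using p fin by (rule finite_part_le)
    also have "\<dots> \<le> (\<Sum>k\<in>F. a / (K + 1) * nrm p (unit_seq k))"
    proof (intro sum_mono mult_right_mono)
      fix k assume "k \<in> F"
      then have "k \<le> M" using F by auto
      then show "norm (y k) \<le> a / (K + 1)" using n(3) y less_imp_le by blast
    qed (rule nrm_nonneg [OF p X_unit])
    also have "\<dots> \<le> (\<Sum>k<M. a / (K + 1) * nrm p (unit_seq k))"
      using F a K nrm_nonneg [OF p X_unit] by (intro sum_mono2) auto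
    also have "\<dots> = a / (K + 1) * K" by (simp add: K_def sum_distrib_left)
    also have "\<dots> < a" using a K by (simp add: field_simps)
    finally show ?thesis .
  qed
  then show ?thesis using n(1,2) by blast
qed

text \<open>
  The coordinate projections onto finite sets are equicontinuous. This is a gliding hump argument:
  otherwise there are arbitrarily small sequences with a projection of norm above \<open>e / 2\<close>, and since
  the head of a small sequence is negligible and its tail can be cut off, they can be taken to live on
  successive intervals. Their sum exists by completeness, and its finite parts do not become small,
  which contradicts unconditional convergence of its expansion.
\<close>
lemma unconditional_equicontinuous:
  assumes U: "unconditional_basis_of T unit_seq" and q: "q \<ge> 1" and e: "e > 0"
  shows "\<exists>n\<ge>1. \<exists>r>0. \<forall>y\<in>X. nrm n y < r \<longrightarrow> (\<forall>F. finite F \<longrightarrow> nrm q (restr F y) \<le> e)"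
proof (rule ccontr)
  assume neg: "\<not> ?thesis"
  have bump: "\<exists>y F N. M < N \<and> y \<in> X \<and> (\<forall>k. k \<notin> {M..<N} \<longrightarrow> y k = 0) \<and> nrm (Suc i) y < (1/2) ^ i \<and>
      F \<subseteq> {M..<N} \<and> e / 2 < nrm q (restr F y)" for M i
  proof -
    \<comment> \<open>the head and the cut-off tail may each cost a quarter of \<open>(1/2) ^ i\<close>, and \<open>y\<close> itself a half; in the
      projection the head costs at most half of \<open>e\<close>\<close>
    define a where "a = min (e / 2) ((1/2) ^ i / 4)"
    have a: "a > 0" using e by (simp add: a_def)
    define p where "p = max q (Suc i)"
    have p: "p \<ge> 1" "q \<le> p" "Suc i \<le> p" by (auto simp: p_def)
    obtain n r where n: "n \<ge> 1" "r > 0" and head: "\<forall>y\<in>X. nrm n y < r \<longrightarrow> (\<forall>F\<subseteq>{..<M}. nrm p (restr F y) < a)"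
      using head_small [OF p(1) a] by blast
    define n' where "n' = max n (Suc i)"
    define r' where "r' = min r ((1/2) ^ i / 2)"
    have "n' \<ge> 1" "r' > 0" using n by (auto simp: n'_def r'_def)
    then obtain y F where y: "y \<in> X" "nrm n' y < r'" and F: "finite F" "e < nrm q (restr F y)"
      using neg by (meson not_le)
    have "nrm n y \<le> nrm n' y" "nrm (Suc i) y \<le> nrm n' y"
      using n y by (auto intro!: nrm_mono simp: n'_def)
    then have ny: "nrm n y < r" "nrm (Suc i) y < (1/2) ^ i / 2" using y(2) by (auto simp: r'_def)
    have hd: "nrm m (restr H y) < a" if "H \<subseteq> {..<M}" "1 \<le> m" "m \<le> p" for H m
    proof -
      have "finite H" using that finite_subset by blast
      then have "nrm m (restr H y) \<le> nrm p (restr H y)" using that by (intro nrm_mono X_restr_finite) auto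
      also have "\<dots> < a" using head y(1) ny(1) that by blast
      finally show ?thesis .
    qed
    have "eventually (\<lambda>N. restr {..<N} y \<in> X \<and> nrm (Suc i) (restr {..<N} y - y) < (1/2) ^ i / 4) sequentially"
      by (rule expansion [OF y(1), unfolded limitin_T, THEN conjunct2, rule_format]) simp_all
    then obtain N0 where N0: "\<And>N. N \<ge> N0 \<Longrightarrow> nrm (Suc i) (restr {..<N} y - y) < (1/2) ^ i / 4"
      unfolding eventually_sequentially by blast
    obtain K where K: "\<And>k. k \<in> F \<Longrightarrow> k < K" using finite_nat_iff_bounded [THEN iffD1, OF F(1)] by blast
    define N where "N = Suc (N0 + K + M)"
    let ?y = "restr {M..<N} y"
    let ?F = "F \<inter> {M..}"
    have yX: "?y \<in> X" by (rule X_restr_finite) simp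
    have "?y = restr {..<N} y - restr {..<M} y" by (auto simp: fun_eq_iff N_def)
    then have "nrm (Suc i) ?y = nrm (Suc i) (restr {..<N} y - restr {..<M} y)" by (rule arg_cong)
    also have "\<dots> \<le> nrm (Suc i) (restr {..<N} y) + nrm (Suc i) (restr {..<M} y)"
      by (intro nrm_diff X_restr_finite) auto
    also have "nrm (Suc i) (restr {..<N} y) \<le> nrm (Suc i) (restr {..<N} y - y) + nrm (Suc i) y"
      using nrm_add [of "Suc i" "restr {..<N} y - y" y] y X_diff X_restr_finite [of "{..<N}" y] by simp
    finally have "nrm (Suc i) ?y \<le> nrm (Suc i) (restr {..<N} y - y) + nrm (Suc i) y + nrm (Suc i) (restr {..<M} y)"
      by this (rule add_right_mono)
    moreover have "nrm (Suc i) (restr {..<M} y) < (1/2) ^ i / 4"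
      using hd [of "{..<M}" "Suc i"] p by (simp add: a_def)
    moreover have "nrm (Suc i) (restr {..<N} y - y) < (1/2) ^ i / 4" by (rule N0) (simp add: N_def)
    ultimately have small: "nrm (Suc i) ?y < (1/2) ^ i" using ny(2) by linarith
    have "restr F y = restr (F \<inter> {..<M}) y + restr ?F y" by (auto simp: fun_eq_iff)
    moreover have "nrm q (restr (F \<inter> {..<M}) y + restr ?F y) \<le> nrm q (restr (F \<inter> {..<M}) y) + nrm q (restr ?F y)"
      using F(1) by (intro nrm_add [OF q] X_restr_finite) auto
    ultimately have "nrm q (restr F y) \<le> nrm q (restr (F \<inter> {..<M}) y) + nrm q (restr ?F y)" by (simp only:)
    moreover have "nrm q (restr (F \<inter> {..<M}) y) < e / 2"
      using hd [of "F \<inter> {..<M}" q] p q by (simp add: a_def)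
    moreover have "restr ?F ?y = restr ?F y" using K by (fastforce simp: fun_eq_iff N_def)
    ultimately have "e / 2 < nrm q (restr ?F ?y)" using F(2) by simp
    moreover have "?F \<subseteq> {M..<N}" using K by (fastforce simp: N_def)
    moreover have "M < N" by (simp add: N_def)
    ultimately show ?thesis using yX small
      by (intro exI [of _ ?y] exI [of _ ?F] exI [of _ N]) auto
  qed
  obtain Y F N where MN: "\<And>M i. M < N M i" and YX: "\<And>M i. Y M i \<in> X"
    and supp: "\<And>M i k. k \<notin> {M..<N M i} \<Longrightarrow> Y M i k = 0"
    and small: "\<And>M i. nrm (Suc i) (Y M i) < (1/2) ^ i"
    and FN: "\<And>M i. F M i \<subseteq> {M..<N M i}" and big: "\<And>M i. e / 2 < nrm q (restr (F M i) (Y M i))"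
    using bump by metis
  define b where "b = rec_nat 0 (\<lambda>i m. N m i)"
  have bSuc: "b (Suc i) = N (b i) i" for i by (simp add: b_def)
  have mono: "strict_mono b" unfolding strict_mono_Suc_iff bSuc using MN by blast
  define y where "y i = Y (b i) i" for i
  have yX: "y i \<in> X" for i by (simp add: y_def YX)
  have ysupp: "y i k = 0" if "k \<notin> {b i..<b (Suc i)}" for i k
    using supp that by (simp add: y_def bSuc)
  have "\<exists>x. limitin T (\<lambda>N. \<Sum>i<N. y i) x sequentially"
  proof (rule series_converges)
    show "summable (\<lambda>i. nrm p (y i))" if p: "p \<ge> 1" for p
    proof (rule summable_comparison_test_ev)
      show "eventually (\<lambda>i. norm (nrm p (y i)) \<le> (1/2) ^ i) sequentially"
        using eventually_ge_at_top [of p]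
      proof eventually_elim
        case (elim i)
        have "nrm p (y i) \<le> nrm (Suc i) (y i)" using p elim yX by (intro nrm_mono) auto
        also have "\<dots> \<le> (1/2) ^ i" using small [of i "b i"] by (simp add: y_def)
        finally show ?case using nrm_nonneg [OF p yX, of i] by simp
      qed
    qed (simp add: summable_geometric)
  qed (use yX in auto)
  then obtain x where x: "limitin T (\<lambda>N. \<Sum>i<N. y i) x sequentially" by blast
  have coord: "x k = y i k" if k: "k \<in> {b i..<b (Suc i)}" for i k
  proof (rule limit_coord_eq [OF x])
    have other: "y l k = 0" if "l \<noteq> i" for l
    proof (rule ysupp)
      from that consider "Suc l \<le> i" | "Suc i \<le> l" by linarith
      then show "k \<notin> {b l..<b (Suc l)}"
      proof cases
        case 1 then show ?thesis using k strict_mono_less_eq [OF mono, of "Suc l" i] by auto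
      next
        case 2 then show ?thesis using k strict_mono_less_eq [OF mono, of "Suc i" l] by auto
      qed
    qed
    show "eventually (\<lambda>N. (\<Sum>i<N. y i) k = y i k) sequentially"
      using eventually_gt_at_top [of i]
    proof eventually_elim
      case (elim N)
      have "(\<Sum>l<N. y l) k = (\<Sum>l<N. if l = i then y i k else 0)"
        unfolding sum_seq_apply using other by (intro sum.cong) auto
      then show ?case using elim by simp
    qed
  qed
  have "x \<in> X" using x by (simp add: limitin_T)
  then obtain L where L: "\<forall>F. finite F \<longrightarrow> F \<subseteq> {L..} \<longrightarrow> nrm q (restr F x) < e / 2"
    using unconditional_finite_tails [OF U _ q, of x "e / 2"] e by auto
  let ?F = "F (b L) L"
  have sub: "?F \<subseteq> {b L..<b (Suc L)}" unfolding bSuc by (rule FN)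
  have "L \<le> b L" using mono by (rule strict_mono_imp_increasing)
  then have "?F \<subseteq> {L..}" using sub by auto
  moreover have "finite ?F" using sub finite_subset by blast
  ultimately have "nrm q (restr ?F x) < e / 2" using L by blast
  moreover have "restr ?F x = restr ?F (y L)" using sub coord [of _ L] by (fastforce simp: fun_eq_iff)
  ultimately show False using big [of "b L" L] by (simp add: y_def)
qed

text \<open>
  A point of the cube \<open>[0,1]\<^sup>F\<close> is a convex combination of its vertices, which correspond to the
  subsets of \<open>F\<close>. The summand \<open>y\<close> is there for the induction, which splits one coordinate at a time.
\<close>
lemma unit_interval_multiplier_le:
  assumes q: "q \<ge> 1" and "finite F" and "\<And>n. 0 \<le> t n \<and> t n \<le> (1::real)" and "y \<in> X"
    and "\<And>G. G \<subseteq> F \<Longrightarrow> nrm q (y + restr G x) \<le> M"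
  shows "nrm q (y + restr F (\<lambda>n. of_real (t n) * x n)) \<le> M"
  using assms(2,4,5)
proof (induction F arbitrary: y)
  case empty
  from empty(2) [of "{}"] show ?case by (simp add: restr_def zero_fun_def [symmetric])
next
  case (insert n F)
  let ?tx = "\<lambda>n. of_real (t n) * x n"
  let ?c = "of_real (t n) :: 'k" and ?d = "of_real (1 - t n) :: 'k"
  let ?y0 = "y + restr F ?tx" and ?y1 = "y + restr {n} x + restr F ?tx"
  have X1: "y + restr {n} x \<in> X" using insert by (intro X_add X_restr_finite) auto
  have "nrm q ?y0 \<le> M" using insert by (intro insert.IH) auto
  moreover have "nrm q ?y1 \<le> M"
  proof (intro insert.IH X1)
    fix G assume G: "G \<subseteq> F"
    then have eq: "y + restr {n} x + restr G x = y + restr (insert n G) x" using insert(2) by (auto simp: fun_eq_iff)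
    have "insert n G \<subseteq> insert n F" using G by blast
    then show "nrm q (y + restr {n} x + restr G x) \<le> M" unfolding eq by (rule insert.prems(2))
  qed
  moreover have mem: "?y0 \<in> X" "?y1 \<in> X" using insert X1 by (auto intro!: X_add X_restr_finite)
  moreover have t: "0 \<le> t n" "0 \<le> 1 - t n" using assms(3) [of n] by auto
  ultimately have "t n * nrm q ?y1 + (1 - t n) * nrm q ?y0 \<le> t n * M + (1 - t n) * M"
    by (intro add_mono mult_left_mono)
  moreover have "nrm q (?c *\<^sub>s ?y1 + ?d *\<^sub>s ?y0) \<le> nrm q (?c *\<^sub>s ?y1) + nrm q (?d *\<^sub>s ?y0)"
    using mem q by (intro nrm_add X_scale)
  moreover have "nrm q (?c *\<^sub>s ?y1) = t n * nrm q ?y1" "nrm q (?d *\<^sub>s ?y0) = (1 - t n) * nrm q ?y0"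
    using t by (simp_all only: nrm_scale [OF q mem(1)] nrm_scale [OF q mem(2)] norm_of_real abs_of_nonneg)
  moreover have "t n * M + (1 - t n) * M = M" by (simp add: algebra_simps)
  ultimately have "nrm q (?c *\<^sub>s ?y1 + ?d *\<^sub>s ?y0) \<le> M" by linarith
  moreover have "y + restr (insert n F) ?tx = ?c *\<^sub>s ?y1 + ?d *\<^sub>s ?y0"
    using insert(2) by (auto simp: fun_eq_iff algebra_simps)
  ultimately show ?case by (simp only:)
qed

text \<open>
  A bounded scalar multiplier decomposes along the real basis of the scalar field, and each real
  component into its positive and negative part; this reduces to multipliers in \<open>[0,1]\<close>.
\<close>
lemma multiplier_le:
  fixes \<theta> :: "nat \<Rightarrow> 'k"
  assumes q: "q \<ge> 1" and F: "finite F" and \<theta>: "\<And>n. norm (\<theta> n) \<le> 1"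
    and M: "\<And>G. G \<subseteq> F \<Longrightarrow> nrm q (restr G x) \<le> M"
  shows "nrm q (restr F (\<lambda>n. \<theta> n * x n)) \<le> 2 * real DIM('k) * M"
proof -
  define P where "P s b = restr F (\<lambda>n. of_real (max 0 (s * (\<theta> n \<bullet> b))) * x n)" for s b
  have PX: "P s b \<in> X" for s b unfolding P_def by (rule X_restr_finite [OF F])
  have P_le: "nrm q (P s b) \<le> M" if "b \<in> Basis" "\<bar>s\<bar> = 1" for s b
  proof -
    have "\<bar>s * (\<theta> n \<bullet> b)\<bar> \<le> 1" for n
      using Basis_le_norm [OF that(1), of "\<theta> n"] \<theta> [of n] that(2) by (simp add: abs_mult)
    then have "0 \<le> max 0 (s * (\<theta> n \<bullet> b)) \<and> max 0 (s * (\<theta> n \<bullet> b)) \<le> 1" for n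
      by (simp add: abs_le_iff)
    from unit_interval_multiplier_le [OF q F this X_zero, of x M] M show ?thesis by (simp add: P_def)
  qed
  have "restr F (\<lambda>n. \<theta> n * x n) = (\<Sum>b\<in>Basis. b *\<^sub>s (P 1 b - P (- 1) b))"
  proof
    fix n
    have "\<theta> n = (\<Sum>b\<in>Basis. b * of_real (\<theta> n \<bullet> b))"
      using euclidean_representation [of "\<theta> n"] by (simp add: scaleR_conv_of_real mult.commute)
    then have "\<theta> n * x n = (\<Sum>b\<in>Basis. b * of_real (\<theta> n \<bullet> b) * x n)"
      by (metis sum_distrib_right)
    also have "\<dots> = (\<Sum>b\<in>Basis. b * (of_real (max 0 (\<theta> n \<bullet> b)) * x n - of_real (max 0 (- (\<theta> n \<bullet> b))) * x n))"
    proof (intro sum.cong refl)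
      fix b :: 'k
      have "\<theta> n \<bullet> b = max 0 (\<theta> n \<bullet> b) - max 0 (- (\<theta> n \<bullet> b))" by simp
      then have "of_real (\<theta> n \<bullet> b) = (of_real (max 0 (\<theta> n \<bullet> b)) - of_real (max 0 (- (\<theta> n \<bullet> b))) :: 'k)"
        by (metis of_real_diff)
      then show "b * of_real (\<theta> n \<bullet> b) * x n =
          b * (of_real (max 0 (\<theta> n \<bullet> b)) * x n - of_real (max 0 (- (\<theta> n \<bullet> b))) * x n)"
        by (simp only: left_diff_distrib mult.assoc)
    qed
    finally show "restr F (\<lambda>n. \<theta> n * x n) n = (\<Sum>b\<in>Basis. b *\<^sub>s (P 1 b - P (- 1) b)) n"
      by (simp add: sum_seq_apply P_def)
  qed
  then have "nrm q (restr F (\<lambda>n. \<theta> n * x n)) = nrm q (\<Sum>b\<in>Basis. b *\<^sub>s (P 1 b - P (- 1) b))"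
    by (rule arg_cong)
  also have "\<dots> \<le> (\<Sum>b\<in>(Basis :: 'k set). norm b) * (2 * M)"
  proof (rule nrm_combination_le [OF q])
    fix b :: 'k assume b: "b \<in> Basis"
    have "nrm q (P 1 b - P (- 1) b) \<le> nrm q (P 1 b) + nrm q (P (- 1) b)" by (rule nrm_diff [OF q PX PX])
    then show "P 1 b - P (- 1) b \<in> X \<and> nrm q (P 1 b - P (- 1) b) \<le> 2 * M"
      using P_le [OF b, of 1] P_le [OF b, of "- 1"] X_diff [OF PX PX] by auto
  qed
  also have "\<dots> = 2 * real DIM('k) * M" by simp
  finally show ?thesis .
qed

lemma multiplier_limit:
  fixes \<theta> :: "nat \<Rightarrow> 'k"
  assumes U: "unconditional_basis_of T unit_seq" and y: "y \<in> X" and \<theta>: "\<And>n. norm (\<theta> n) \<le> 1"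
  shows "limitin T (\<lambda>N. restr {..<N} (\<lambda>n. \<theta> n * y n)) (\<lambda>n. \<theta> n * y n) sequentially"
proof -
  let ?z = "\<lambda>n. \<theta> n * y n"
  have "\<exists>s. limitin T (\<lambda>N. restr {..<N} ?z) s sequentially"
  proof (rule cauchy_limit)
    show "range (\<lambda>N. restr {..<N} ?z) \<subseteq> X" by (auto intro: X_restr_finite)
    fix q :: nat and r :: real assume q: "q \<ge> 1" and r: "r > 0"
    define e where "e = r / (4 * real DIM('k))"
    have e: "e > 0" using r by (simp add: e_def)
    obtain N where N: "\<forall>F. finite F \<longrightarrow> F \<subseteq> {N..} \<longrightarrow> nrm q (restr F y) < e"
      using unconditional_finite_tails [OF U y q e] by blast
    have *: "nrm q (restr {..<k} ?z - restr {..<m} ?z) < r" if "N \<le> m" "m \<le> k" for m k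
    proof -
      have "nrm q (restr G y) \<le> e" if "G \<subseteq> {m..<k}" for G
      proof -
        have "finite G" "G \<subseteq> {N..}" using that \<open>N \<le> m\<close> by (auto intro: finite_subset)
        then show ?thesis using N less_imp_le by blast
      qed
      then have "nrm q (restr {m..<k} ?z) \<le> 2 * real DIM('k) * e"
        using \<theta> by (intro multiplier_le [OF q]) auto
      also have "\<dots> = r / 2" by (simp add: e_def)
      also have "\<dots> < r" using r by simp
      finally have "nrm q (restr {m..<k} ?z) < r" .
      moreover have "restr {..<k} ?z - restr {..<m} ?z = restr {m..<k} ?z" using that by (auto simp: fun_eq_iff)
      ultimately show ?thesis by simp
    qed
    have "nrm q (restr {..<k} ?z - restr {..<m} ?z) < r" if "N \<le> m" "N \<le> k" for m k
    proof (cases "m \<le> k")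
      case False
      then show ?thesis using * [of k m] that nrm_minus_commute [OF q] X_restr_finite by simp
    qed (use * that in auto)
    then show "\<exists>N. \<forall>i\<ge>N. \<forall>j\<ge>N. nrm q (restr {..<i} ?z - restr {..<j} ?z) < r" by blast
  qed
  then obtain s where s: "limitin T (\<lambda>N. restr {..<N} ?z) s sequentially" by blast
  have "s k = ?z k" for k
  proof (rule limit_coord_eq [OF s])
    show "eventually (\<lambda>N. restr {..<N} ?z k = ?z k) sequentially"
      using eventually_gt_at_top [of k] by eventually_elim simp
  qed
  then have "s = ?z" by blast
  then show ?thesis using s by simp
qed

lemma multiplier_X:
  fixes \<theta> :: "nat \<Rightarrow> 'k"
  assumes "unconditional_basis_of T unit_seq" "y \<in> X" "\<And>n. norm (\<theta> n) \<le> 1"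
  shows "(\<lambda>n. \<theta> n * y n) \<in> X"
  using multiplier_limit [OF assms] by (simp add: limitin_T)

text \<open>
  Equicontinuity of the finite projections carries over to multipliers with finite support at the cost of
  the factor \<open>2 DIM('k)\<close>, and then to all multipliers bounded by 1 in the limit.
\<close>
lemma multipliers_equicontinuous:
  assumes U: "unconditional_basis_of T unit_seq" and q: "q \<ge> 1" and e: "e > 0"
  shows "\<exists>n\<ge>1. \<exists>r>0. \<forall>y\<in>X. nrm n y < r \<longrightarrow>
    (\<forall>\<theta> :: nat \<Rightarrow> 'k. (\<forall>k. norm (\<theta> k) \<le> 1) \<longrightarrow> nrm q (\<lambda>k. \<theta> k * y k) < e)"
proof -
  define e' where "e' = e / (4 * real DIM('k))"
  have "e' > 0" using e by (simp add: e'_def)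
  from unconditional_equicontinuous [OF U q this] obtain n r where n: "n \<ge> 1" "r > 0"
    and F: "\<forall>y\<in>X. nrm n y < r \<longrightarrow> (\<forall>F. finite F \<longrightarrow> nrm q (restr F y) \<le> e')" by blast
  have "nrm q (\<lambda>k. \<theta> k * y k) < e" if y: "y \<in> X" "nrm n y < r" and \<theta>: "\<And>k. norm (\<theta> k) \<le> 1"
    for y and \<theta> :: "nat \<Rightarrow> 'k"
  proof -
    have "nrm q (restr {..<N} (\<lambda>k. \<theta> k * y k)) \<le> e / 2" for N
    proof -
      have "nrm q (restr G y) \<le> e'" if "G \<subseteq> {..<N}" for G
        using F y that finite_subset by blast
      then have "nrm q (restr {..<N} (\<lambda>k. \<theta> k * y k)) \<le> 2 * real DIM('k) * e'"
        using \<theta> by (intro multiplier_le [OF q]) auto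
      then show ?thesis by (simp add: e'_def)
    qed
    then have "nrm q ((\<lambda>k. \<theta> k * y k) - 0) \<le> e / 2"
      by (intro nrm_limit_le [OF multiplier_limit [OF U y(1) \<theta>] q X_zero]) simp
    then show ?thesis using e by simp
  qed
  then show ?thesis using n by blast
qed

end

section \<open>Hypercyclicity implies the condition\<close>

context frechet_shift
begin

text \<open>
  Take the return times of the hypercyclic vector \<open>x\<close> to small neighbourhoods of
  \<open>y\<^sub>p = \<Sum>\<^sub>j\<^sub>\<le>\<^sub>p a\<^sub>p\<^sub>j v\<^sub>j e\<^sub>j\<close> as the set \<open>A\<^sub>p\<close>. If \<open>n\<close> is such a time, then \<open>x\<^sub>n\<^sub>+\<^sub>j / v\<^sub>n\<^sub>+\<^sub>j\<close> is within \<open>1/2\<close> of \<open>a\<^sub>p\<^sub>j\<close>, so the series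
  of the condition arise from \<open>x\<close> and from \<open>B\<^sup>m x - y\<^sub>q\<close> by multipliers of size at most \<open>1/p\<close>, and
  unconditionality controls them. Integer codes \<open>a\<^sub>p\<^sub>j\<close> within distance less than 1 of each other are equal;
  choosing them even for \<open>j = 0\<close>, depending injectively on \<open>p\<close>, and odd for \<open>j > 0\<close> makes the sets
  disjoint and forces their gaps to exceed \<open>q\<close>. The gaps put the series outside the support of \<open>y\<^sub>q\<close>,
  which is why only the small vector \<open>B\<^sup>m x - y\<^sub>q\<close> matters.
\<close>
lemma shift_condition_if_hypercyclic:
  assumes U: "unconditional_basis_of T unit_seq" and H: "hypercyclic_wrt \<A> T B"
  shows "shift_condition X nrm w \<A> (\<lambda>p. 1 / real p)"
proof -
  obtain x where x: "x \<in> X" and ret: "\<And>V. openin T V \<Longrightarrow> V \<noteq> {} \<Longrightarrow> {n. (B ^^ n) x \<in> V} \<in> \<A>"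
    using H unfolding hypercyclic_wrt_def topspace_T by blast
  define a :: "nat \<Rightarrow> nat \<Rightarrow> int" where "a p j = (if j = 0 then 2 * int p else 2 * int p + 1)" for p j
  define y where "y p = restr {..p} (\<lambda>j. of_int (a p j) * v j)" for p
  have yX: "y p \<in> X" for p unfolding y_def by (rule X_restr_finite) simp
  define good where "good p n r \<longleftrightarrow> n \<ge> 1 \<and> r > 0 \<and>
      (\<forall>g\<in>X. nrm n g < r \<longrightarrow> (\<forall>j\<le>p. norm (g j) < norm (v j) / 2) \<and>
        (\<forall>\<theta> :: nat \<Rightarrow> 'k. (\<forall>k. norm (\<theta> k) \<le> 1) \<longrightarrow> nrm p (\<lambda>k. \<theta> k * g k) < 1 / real p))"
    for p n :: nat and r :: real
  have "\<exists>n r. good p n r" if p: "p \<ge> 1" for p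
  proof -
    obtain n1 r1 where n1: "n1 \<ge> 1" "r1 > 0"
      and 1: "\<forall>g\<in>X. nrm n1 g < r1 \<longrightarrow> (\<forall>j\<le>p. norm (g j) < norm (v j) / 2)"
      using coords_small [of p "\<lambda>j. norm (v j) / 2"] by auto
    have "1 / real p > 0" using p by simp
    from multipliers_equicontinuous [OF U p this] obtain n2 r2 where n2: "n2 \<ge> 1" "r2 > 0"
      and 2: "\<forall>g\<in>X. nrm n2 g < r2 \<longrightarrow>
        (\<forall>\<theta> :: nat \<Rightarrow> 'k. (\<forall>k. norm (\<theta> k) \<le> 1) \<longrightarrow> nrm p (\<lambda>k. \<theta> k * g k) < 1 / real p)" by blast
    have "nrm n1 g < r1 \<and> nrm n2 g < r2" if "g \<in> X" "nrm (max n1 n2) g < min r1 r2" for g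
      using that n1(1) n2(1) nrm_mono [of n1 "max n1 n2" g] nrm_mono [of n2 "max n1 n2" g] by simp
    then show ?thesis unfolding good_def using n1 n2 1 2
      by (intro exI [of _ "max n1 n2"] exI [of _ "min r1 r2"] conjI) auto
  qed
  then obtain n r where good: "\<And>p. p \<ge> 1 \<Longrightarrow> good p (n p) (r p)" by metis
  have n: "\<And>p. p \<ge> 1 \<Longrightarrow> n p \<ge> 1" and r: "\<And>p. p \<ge> 1 \<Longrightarrow> r p > 0"
    and coord: "\<And>p g j. p \<ge> 1 \<Longrightarrow> g \<in> X \<Longrightarrow> nrm (n p) g < r p \<Longrightarrow> j \<le> p \<Longrightarrow> norm (g j) < norm (v j) / 2"
    and mult: "\<And>p g \<theta>. p \<ge> 1 \<Longrightarrow> g \<in> X \<Longrightarrow> nrm (n p) g < r p \<Longrightarrow> \<forall>k. norm (\<theta> k :: 'k) \<le> 1 \<Longrightarrow>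
      nrm p (\<lambda>k. \<theta> k * g k) < 1 / real p"
    using good unfolding good_def by blast+
  define A where "A p = {m. (B ^^ m) x \<in> {g \<in> X. nrm (n p) (g - y p) < r p}}" for p
  have A_mem: "A p \<in> \<A>" if "p \<ge> 1" for p
    unfolding A_def
  proof (rule ret)
    show "openin T {g \<in> X. nrm (n p) (g - y p) < r p}" using n r yX that by (intro openin_ball) auto
    have "y p \<in> {g \<in> X. nrm (n p) (g - y p) < r p}" using yX n [OF that] r [OF that] by (simp add: nrm_zero)
    then show "{g \<in> X. nrm (n p) (g - y p) < r p} \<noteq> {}" by blast
  qed
  have BX: "(B ^^ m) x \<in> X" for m by (rule B_pow_X [OF x])
  have near: "nrm (n p) ((B ^^ m) x - y p) < r p" if "m \<in> A p" for m p
    using that by (simp add: A_def)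

  define \<rho> where "\<rho> k = x k / v k" for k
  have ratio: "norm (\<rho> (m + j) - of_int (a p j)) < 1/2" if p: "p \<ge> 1" and m: "m \<in> A p" and j: "j \<le> p" for p m j
  proof -
    have "((B ^^ m) x - y p) j = v j * (\<rho> (m + j) - of_int (a p j))"
      using j by (simp add: B_pow_apply y_def \<rho>_def algebra_simps)
    moreover have "norm (((B ^^ m) x - y p) j) < norm (v j) / 2"
      using coord [OF p X_diff [OF BX yX] near [OF m] j] .
    ultimately have "norm (v j) * norm (\<rho> (m + j) - of_int (a p j)) < norm (v j) * (1/2)"
      by (simp add: norm_mult)
    then show ?thesis by (rule mult_less_cancel_left_pos [THEN iffD1, rotated]) simp
  qed
  \<comment> \<open>both codes approximate the same number \<open>\<rho> (m + i)\<close>\<close>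
  have same: "a p i = a q j" if "p \<ge> 1" "q \<ge> 1" "m \<in> A p" "m' \<in> A q" "i \<le> p" "j \<le> q" "m + i = m' + j"
    for p q m m' i j
  proof -
    have "norm (of_int (a p i) - of_int (a q j) :: 'k) =
        norm ((\<rho> (m' + j) - of_int (a q j)) - (\<rho> (m + i) - of_int (a p i)))" by (simp add: that)
    also have "\<dots> \<le> norm (\<rho> (m' + j) - of_int (a q j)) + norm (\<rho> (m + i) - of_int (a p i))"
      by (rule norm_triangle_ineq4)
    also have "\<dots> < 1" using ratio that by (smt (verit) field_sum_of_halves)
    finally have "norm (of_int (a p i - a q j) :: 'k) < 1" by simp
    then have "\<bar>a p i - a q j\<bar> < 1" by (simp only: norm_of_int)
    then show ?thesis by simp
  qed
  have disj: "A p \<inter> A q = {}" if "p \<ge> 1" "q \<ge> 1" "p \<noteq> q" for p q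
    using same [of p q _ _ 0 0] that by (auto simp: a_def)
  have gap: "q < m' - m" if "p \<ge> 1" "q \<ge> 1" "m' \<in> A p" "m \<in> A q" "m < m'" for p q m m'
  proof (rule ccontr)
    assume "\<not> q < m' - m"
    then have "a p 0 = a q (m' - m)" using that by (intro same [of p q m' m]) auto
    moreover have "even (a p 0)" "odd (a q (m' - m))" using that by (simp_all add: a_def)
    ultimately show False by simp
  qed
  have \<rho>_large: "norm (\<rho> (m + j)) \<ge> real p" if "p \<ge> 1" "m \<in> A p" "j \<le> p" for p m j
  proof -
    have "norm (of_int (a p j) :: 'k) \<ge> 2 * real p" by (simp only: norm_of_int) (simp add: a_def)
    moreover have "norm (of_int (a p j) :: 'k) \<le> norm (\<rho> (m + j)) + norm (\<rho> (m + j) - of_int (a p j))"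
      by (metis norm_minus_commute norm_triangle_sub)
    ultimately show ?thesis using ratio [OF that] that(1) by linarith
  qed

  have i: "chi ((\<lambda>n. n + p) ` A p) \<in> X" if p: "p \<ge> 1" for p
  proof -
    let ?S = "(\<lambda>n. n + p) ` A p"
    define \<theta> where "\<theta> k = (if k \<in> ?S then 1 / \<rho> k else 0)" for k
    have large: "norm (\<rho> k) \<ge> 1" if "k \<in> ?S" for k using that \<rho>_large [OF p _ order_refl] p by fastforce
    have "norm (\<theta> k) \<le> 1" for k
    proof (cases "k \<in> ?S")
      case True
      then have "norm (\<theta> k) = 1 / norm (\<rho> k)"
        unfolding \<theta>_def by (simp only: if_True norm_divide norm_one)
      also have "\<dots> \<le> 1" using large [OF True] by (intro divide_le_eq_1_pos [THEN iffD2]) auto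
      finally show ?thesis .
    qed (simp add: \<theta>_def)
    then have "(\<lambda>k. \<theta> k * x k) \<in> X" using multiplier_X [OF U x] by blast
    moreover have "\<theta> k * x k = chi ?S k" for k
      using large [of k] by (auto simp: \<theta>_def \<rho>_def)
    ultimately show ?thesis by (simp only: eta_contract_eq)
  qed
  have ii: "chi (shifted_tail (A p) m j) \<in> X \<and>
      nrm q (chi (shifted_tail (A p) m j)) < min (1 / real p) (1 / real q)"
    if p: "p \<ge> 1" and q: "q \<ge> 1" and m: "m \<in> A q" and j: "j \<le> p" for p q m j
  proof -
    let ?S = "shifted_tail (A p) m j"
    let ?g = "(B ^^ m) x - y q"
    have gX: "?g \<in> X" by (rule X_diff [OF BX yX])
    have S: "q < k \<and> norm (\<rho> (k + m)) \<ge> real p" if k: "k \<in> ?S" for k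
    proof -
      obtain n' where n': "n' \<in> A p" "m < n'" "k = n' - m + j" using k by (auto simp: shifted_tail_def)
      have "k + m = n' + j" using n' by simp
      then show ?thesis using gap [OF p q n'(1) m n'(2)] \<rho>_large [OF p n'(1) j] n'(3) by simp
    qed
    define \<theta> where "\<theta> k = (if k \<in> ?S then of_nat p / \<rho> (k + m) else 0)" for k
    have \<theta>: "\<forall>k. norm (\<theta> k) \<le> 1"
    proof
      fix k show "norm (\<theta> k) \<le> 1" using S [of k] p by (auto simp: \<theta>_def norm_divide divide_le_eq)
    qed
    \<comment> \<open>the factor \<open>1 / p\<close> is kept outside of the multiplier: it supplies the bound \<open>1 / p\<close>, and the
      neighbourhood of \<open>y q\<close> the bound \<open>1 / q\<close>\<close>
    have "chi ?S k = (1 / of_nat p) * (\<theta> k * ?g k)" for k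
    proof (cases "k \<in> ?S")
      case True
      then have "norm (\<rho> (k + m)) > 0" "q < k" using S [of k] p by auto
      then have "x (k + m) \<noteq> 0" "y q k = 0" by (auto simp: \<rho>_def y_def)
      then show ?thesis using True p by (simp add: \<theta>_def \<rho>_def B_pow_apply)
    qed (simp add: \<theta>_def)
    then have chi: "chi ?S = (1 / of_nat p) *\<^sub>s (\<lambda>k. \<theta> k * ?g k)" by (simp only: fun_eq_iff scale_apply simp_thms)
    have mX: "(\<lambda>k. \<theta> k * ?g k) \<in> X" using multiplier_X [OF U gX] \<theta> by blast
    have "nrm q (chi ?S) = 1 / real p * nrm q (\<lambda>k. \<theta> k * ?g k)"
      unfolding chi nrm_scale [OF q mX] by (simp only: norm_divide norm_one norm_of_nat)
    also have "\<dots> < 1 / real p * (1 / real q)"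
      using mult [OF q gX near [OF m] \<theta>] p by (intro mult_strict_left_mono) auto
    also have "\<dots> \<le> min (1 / real p) (1 / real q)"
      using p q by (simp add: field_simps)
    finally show ?thesis using X_scale [OF mX, of "1 / of_nat p"] by (simp only: chi simp_thms)
  qed
  show ?thesis unfolding shift_condition_iff
    using A_mem disj i ii by (intro exI [of _ A]) (auto simp: disjoint_family_on_def)
qed

end

theorem theorem33:
  fixes X :: "(nat \<Rightarrow> 'k::{real_normed_field, euclidean_space}) set"
    and nrm :: "nat \<Rightarrow> (nat \<Rightarrow> 'k) \<Rightarrow> real"
    and w :: "nat \<Rightarrow> 'k"
    and \<A> :: "nat set set"
  assumes "frechet_sequence_space X nrm"
    and "basis_of (seminorm_topology X nrm) unit_seq"
    and "\<forall>n\<ge>1. w n \<noteq> 0"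
    and "operator_on (seminorm_topology X nrm) (weighted_shift w)"
    and "furstenberg_family \<A>"
    and "finitely_invariant \<A>"
  shows "((\<exists>\<epsilon>. positive_null_seq \<epsilon> \<and> shift_condition X nrm w \<A> \<epsilon>) \<longrightarrow>
        hypercyclic_wrt \<A> (seminorm_topology X nrm) (weighted_shift w)) \<and>
    (unconditional_basis_of (seminorm_topology X nrm) unit_seq \<longrightarrow>
      hypercyclic_wrt \<A> (seminorm_topology X nrm) (weighted_shift w) \<longrightarrow>
        (\<exists>\<epsilon>. positive_null_seq \<epsilon> \<and> shift_condition X nrm w \<A> \<epsilon>)) \<and>
    ((\<exists>\<epsilon>. positive_null_seq \<epsilon> \<and> shift_condition X nrm w \<A> \<epsilon>) \<longleftrightarrow>
      (\<forall>\<epsilon>. positive_null_seq \<epsilon> \<longrightarrow> shift_condition X nrm w \<A> \<epsilon>))"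
proof -
  interpret frechet_shift X nrm w
    using assms by unfold_locales auto
  have harmonic: "positive_null_seq (\<lambda>p. 1 / real p)"
    unfolding positive_null_seq_def using lim_1_over_n [where 'a = real] by auto
  show ?thesis
    using hypercyclic_if_shift_condition [OF _ _ assms(5)] shift_condition_if_hypercyclic
      shift_condition_any_null_seq harmonic by blast
qed

end
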